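(* Let $m\ge1$, points $z_1,\dots,z_m\in\mathbf{R}^2$, positive integers $n_1,\dots,n_m$ and $l>0$ be fixed. For $\kappa,q>0$ with $q^2/\kappa=l$ let $(v^{\kappa,q},A_0^{\kappa,q})$ be an admissible topological solution (as defined in the context) of $$\Delta v=2q^2(e^{v+f}-1)-2q\kappa A_0+g,\qquad \Delta A_0=\kappa q(1-e^{v+f})+(\kappa^2+2q^2e^{v+f})A_0\quad\text{on }\mathbf{R}^2.$$ Then for every $\psi\in C_0^\infty(\mathbf{R}^2)$, $$\lim_{\kappa,q\to\infty}\int_{\mathbf{R}^2}\Big[\Delta v^{\kappa,q}-4l^2e^{v^{\kappa,q}+f}\big(e^{v^{\kappa,q}+f}-1\big)-g\Big]\psi\,dx=0,$$ where the limit is taken along $\kappa,q\to\infty$ with $q^2/\kappa=l$ kept fixed.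
   Context: Define $$f(z)=\sum_{j=1}^m n_j\ln\left(\frac{|z-z_j|^2}{1+|z-z_j|^2}\right),\qquad g(z)=\sum_{j=1}^m\frac{4n_j}{(1+|z-z_j|^2)^2}.$$ A topological solution is a smooth real-valued pair $(v,A_0)$ on $\mathbf{R}^2$ satisfying the system with $v\to0$ and $A_0\to0$ as $|z|\to\infty$. Let $v_a^q\in H^2(\mathbf{R}^2)\cap C^\infty(\mathbf{R}^2)$ be the unique (finite energy Abelian Higgs) solution of $\Delta v_a^q=2q^2(e^{v_a^q+f}-1)+g$. A topological solution $(v,A_0)$ is called admissible if any one of the following four (mutually equivalent) conditions holds on $\mathbf{R}^2$: (i) $A_0\le0$; (ii) $v\le-f$; (iii) $A_0\ge\frac q\kappa(e^{v+f}-1)$; (iv) $v\le v_a^q$. *)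

theory Defs
  imports "HOL-Analysis.Analysis"
begin

type_synonym plane = "real ^ 2"

definition partial_deriv :: "'a::euclidean_space \<Rightarrow> ('a \<Rightarrow> real) \<Rightarrow> 'a \<Rightarrow> real" where
  "partial_deriv b u x = deriv (\<lambda>t. u (x + t *\<^sub>R b)) 0"

definition laplacian :: "('a::euclidean_space \<Rightarrow> real) \<Rightarrow> 'a \<Rightarrow> real" where
  "laplacian u x = (\<Sum>b\<in>Basis. partial_deriv b (partial_deriv b u) x)"

primrec C_k :: "nat \<Rightarrow> ('a::euclidean_space \<Rightarrow> real) \<Rightarrow> bool" where
  "C_k 0 u \<longleftrightarrow> continuous_on UNIV u"
| "C_k (Suc k) u \<longleftrightarrow> u differentiable_on UNIV \<and> (\<forall>b\<in>Basis. C_k k (partial_deriv b u))"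

definition smooth :: "('a::euclidean_space \<Rightarrow> real) \<Rightarrow> bool" where
  "smooth u \<longleftrightarrow> (\<forall>k. C_k k u)"

definition test_function :: "('a::euclidean_space \<Rightarrow> real) \<Rightarrow> bool" where
  "test_function \<psi> \<longleftrightarrow> smooth \<psi> \<and> compact (closure {x. \<psi> x \<noteq> 0})"

definition square_integrable :: "('a::euclidean_space \<Rightarrow> real) \<Rightarrow> bool" where
  "square_integrable u \<longleftrightarrow> u \<in> borel_measurable lborel \<and> integrable lborel (\<lambda>x. (u x)\<^sup>2)"

(* Only used for square-integrable u and w, so both integrands are integrable. *)
definition weak_partial_deriv ::
  "'a::euclidean_space \<Rightarrow> ('a \<Rightarrow> real) \<Rightarrow> ('a \<Rightarrow> real) \<Rightarrow> bool" where
  "weak_partial_deriv b u w \<longleftrightarrow>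
     (\<forall>\<phi>. test_function \<phi> \<longrightarrow>
        (LINT x|lborel. u x * partial_deriv b \<phi> x) = - (LINT x|lborel. w x * \<phi> x))"

(* The Sobolev space H^k = W^(k,2) on the whole space, as a predicate on representatives. *)
primrec sobolev_H :: "nat \<Rightarrow> ('a::euclidean_space \<Rightarrow> real) \<Rightarrow> bool" where
  "sobolev_H 0 u \<longleftrightarrow> square_integrable u"
| "sobolev_H (Suc k) u \<longleftrightarrow> square_integrable u \<and>
     (\<forall>b\<in>Basis. \<exists>w. weak_partial_deriv b u w \<and> sobolev_H k w)"

(* The points are z 1, ..., z m with weights n 1, ..., n m.  At a point z j the mathematical
   value is -infinity, whereas ln 0 = 0 here; the value of f at z j is therefore never used below. *)
definition f_bg :: "nat \<Rightarrow> (nat \<Rightarrow> plane) \<Rightarrow> (nat \<Rightarrow> nat) \<Rightarrow> plane \<Rightarrow> real" where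
  "f_bg m z n x =
     (\<Sum>j=1..m. real (n j) * ln ((norm (x - z j))\<^sup>2 / (1 + (norm (x - z j))\<^sup>2)))"

definition g_bg :: "nat \<Rightarrow> (nat \<Rightarrow> plane) \<Rightarrow> (nat \<Rightarrow> nat) \<Rightarrow> plane \<Rightarrow> real" where
  "g_bg m z n x = (\<Sum>j=1..m. 4 * real (n j) / (1 + (norm (x - z j))\<^sup>2)\<^sup>2)"

(* e^(v+f), with e^(-infinity) = 0 at the points z j. *)
definition exp_vf ::
  "nat \<Rightarrow> (nat \<Rightarrow> plane) \<Rightarrow> (nat \<Rightarrow> nat) \<Rightarrow> (plane \<Rightarrow> real) \<Rightarrow> plane \<Rightarrow> real" where
  "exp_vf m z n v x = (if x \<in> z ` {1..m} then 0 else exp (v x + f_bg m z n x))"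

definition topological_solution ::
  "nat \<Rightarrow> (nat \<Rightarrow> plane) \<Rightarrow> (nat \<Rightarrow> nat) \<Rightarrow> real \<Rightarrow> real \<Rightarrow>
   (plane \<Rightarrow> real) \<Rightarrow> (plane \<Rightarrow> real) \<Rightarrow> bool" where
  "topological_solution m z n \<kappa> q v A\<^sub>0 \<longleftrightarrow>
     smooth v \<and> smooth A\<^sub>0 \<and>
     (\<forall>x. laplacian v x =
        2 * q\<^sup>2 * (exp_vf m z n v x - 1) - 2 * q * \<kappa> * A\<^sub>0 x + g_bg m z n x) \<and>
     (\<forall>x. laplacian A\<^sub>0 x =
        \<kappa> * q * (1 - exp_vf m z n v x) + (\<kappa>\<^sup>2 + 2 * q\<^sup>2 * exp_vf m z n v x) * A\<^sub>0 x) \<and>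
     (v \<longlongrightarrow> 0) at_infinity \<and> (A\<^sub>0 \<longlongrightarrow> 0) at_infinity"

definition abelian_higgs_solution ::
  "nat \<Rightarrow> (nat \<Rightarrow> plane) \<Rightarrow> (nat \<Rightarrow> nat) \<Rightarrow> real \<Rightarrow> (plane \<Rightarrow> real) \<Rightarrow> bool" where
  "abelian_higgs_solution m z n q w \<longleftrightarrow>
     sobolev_H 2 w \<and> smooth w \<and>
     (\<forall>x. laplacian w x = 2 * q\<^sup>2 * (exp_vf m z n w x - 1) + g_bg m z n x)"

(* The four disjuncts are the mutually equivalent conditions A0 <= 0, v <= -f,
   A0 >= (q/kappa)(e^(v+f) - 1) and v <= v_a, each on the whole plane.  In the second one -f is
   +infinity at the points z j, so nothing is required there.  In the fourth one w is the
   solution v_a of the Abelian Higgs equation, which exists and is unique. *)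
definition admissible ::
  "nat \<Rightarrow> (nat \<Rightarrow> plane) \<Rightarrow> (nat \<Rightarrow> nat) \<Rightarrow> real \<Rightarrow> real \<Rightarrow>
   (plane \<Rightarrow> real) \<Rightarrow> (plane \<Rightarrow> real) \<Rightarrow> bool" where
  "admissible m z n \<kappa> q v A\<^sub>0 \<longleftrightarrow>
     (\<forall>x. A\<^sub>0 x \<le> 0) \<or>
     (\<forall>x. x \<notin> z ` {1..m} \<longrightarrow> v x \<le> - f_bg m z n x) \<or>
     (\<forall>x. A\<^sub>0 x \<ge> q / \<kappa> * (exp_vf m z n v x - 1)) \<or>
     (\<exists>w. abelian_higgs_solution m z n q w \<and> (\<forall>x. v x \<le> w x))"

end

theory Submission
  imports Defs
begin

text \<open>Put \<open>\<phi> = e\<^sup>v\<^sup>+\<^sup>f\<close> and \<open>H = \<kappa> A\<^sub>0 - q (\<phi> - 1)\<close>. The maximum principle, together with a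
  Keller--Osserman barrier for the fourth admissibility condition, gives \<open>\<phi> \<le> 1\<close>, \<open>A\<^sub>0 \<le> 0\<close> and
  \<open>H \<ge> 0\<close>, hence \<open>|A\<^sub>0| \<le> q / \<kappa>\<close>. The second equation reads \<open>\<Delta>A\<^sub>0 = \<kappa> H + 2 q\<^sup>2 \<phi> A\<^sub>0\<close>, so testing it
  against a cutoff and moving the Laplacian onto the cutoff bounds \<open>H\<close> locally in \<open>L\<^sup>1\<close> by
  \<open>O(q / \<kappa>)\<close>. Combining both equations,
  \<open>\<Delta>v - 4 l\<^sup>2 \<phi> (\<phi> - 1) - g = (4 l\<^sup>2 / q) \<phi> H - (2 q / \<kappa>) \<Delta>A\<^sub>0\<close>,
  and tested against \<open>\<psi>\<close> both terms on the right are \<open>O(1 / \<kappa>)\<close>.\<close>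

section \<open>Pointwise Laplacians and the maximum principle\<close>

text \<open>\<open>laplacian\<close> rests on \<open>deriv\<close>, which has a value even where
  nothing is differentiable, and \<open>f_bg\<close> is singular at the vortices. This relation
  certifies the derivatives along coordinate lines: first ones near the point, second ones at it,
  which is all the maximum principle uses.\<close>

definition has_laplacian_at :: "('a::euclidean_space \<Rightarrow> real) \<Rightarrow> 'a \<Rightarrow> real \<Rightarrow> bool" where
  "has_laplacian_at u x L \<longleftrightarrow> (\<exists>u1 u2. L = (\<Sum>b\<in>Basis. u2 b) \<and>
     (\<forall>b\<in>Basis. (\<forall>\<^sub>F t in nhds 0. ((\<lambda>s. u (x + s *\<^sub>R b)) has_real_derivative u1 b t) (at t)) \<and>
        (u1 b has_real_derivative u2 b) (at 0)))"

lemma has_laplacian_atI: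
  assumes "\<And>b. b \<in> Basis \<Longrightarrow>
      \<forall>\<^sub>F t in nhds 0. ((\<lambda>s. u (x + s *\<^sub>R b)) has_real_derivative u1 b t) (at t)"
    and "\<And>b. b \<in> Basis \<Longrightarrow> (u1 b has_real_derivative u2 b) (at 0)"
    and "L = (\<Sum>b\<in>Basis. u2 b)"
  shows "has_laplacian_at u x L"
  unfolding has_laplacian_at_def using assms by blast

lemma has_laplacian_at_add:
  assumes "has_laplacian_at u x L" "has_laplacian_at w x K"
  shows "has_laplacian_at (\<lambda>y. u y + w y) x (L + K)"
proof -
  obtain u1 u2 where u: "L = (\<Sum>b\<in>Basis. u2 b)"
    "\<And>b. b \<in> Basis \<Longrightarrow>
      \<forall>\<^sub>F t in nhds 0. ((\<lambda>s. u (x + s *\<^sub>R b)) has_real_derivative u1 b t) (at t)"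
    "\<And>b. b \<in> Basis \<Longrightarrow> (u1 b has_real_derivative u2 b) (at 0)"
    using assms(1) unfolding has_laplacian_at_def by blast
  obtain w1 w2 where w: "K = (\<Sum>b\<in>Basis. w2 b)"
    "\<And>b. b \<in> Basis \<Longrightarrow>
      \<forall>\<^sub>F t in nhds 0. ((\<lambda>s. w (x + s *\<^sub>R b)) has_real_derivative w1 b t) (at t)"
    "\<And>b. b \<in> Basis \<Longrightarrow> (w1 b has_real_derivative w2 b) (at 0)"
    using assms(2) unfolding has_laplacian_at_def by blast
  show ?thesis
  proof (rule has_laplacian_atI)
    fix b :: 'a assume b: "b \<in> Basis"
    show "\<forall>\<^sub>F t in nhds 0. ((\<lambda>s. u (x + s *\<^sub>R b) + w (x + s *\<^sub>R b))
        has_real_derivative u1 b t + w1 b t) (at t)"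
      using u(2)[OF b] w(2)[OF b] by eventually_elim (rule DERIV_add)
    show "((\<lambda>t. u1 b t + w1 b t) has_real_derivative u2 b + w2 b) (at 0)"
      using u(3)[OF b] w(3)[OF b] by (rule DERIV_add)
  qed (simp add: u(1) w(1) sum.distrib)
qed

lemma has_laplacian_at_const: "has_laplacian_at (\<lambda>y. c) x 0"
  by (rule has_laplacian_atI[where ?u1.0="\<lambda>_ _. 0" and ?u2.0="\<lambda>_. 0"]) auto

lemma has_laplacian_at_cmult:
  assumes "has_laplacian_at u x L"
  shows "has_laplacian_at (\<lambda>y. c * u y) x (c * L)"
proof -
  obtain u1 u2 where u: "L = (\<Sum>b\<in>Basis. u2 b)"
    "\<And>b. b \<in> Basis \<Longrightarrow>
      \<forall>\<^sub>F t in nhds 0. ((\<lambda>s. u (x + s *\<^sub>R b)) has_real_derivative u1 b t) (at t)"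
    "\<And>b. b \<in> Basis \<Longrightarrow> (u1 b has_real_derivative u2 b) (at 0)"
    using assms(1) unfolding has_laplacian_at_def by blast
  show ?thesis
  proof (rule has_laplacian_atI)
    fix b :: 'a assume b: "b \<in> Basis"
    show "\<forall>\<^sub>F t in nhds 0. ((\<lambda>s. c * u (x + s *\<^sub>R b))
        has_real_derivative c * u1 b t) (at t)"
      using u(2)[OF b] by eventually_elim (rule DERIV_cmult)
    show "((\<lambda>t. c * u1 b t) has_real_derivative c * u2 b) (at 0)"
      using u(3)[OF b] by (rule DERIV_cmult)
  qed (simp add: u(1) sum_distrib_left)
qed

lemma has_laplacian_at_sum:
  assumes "\<And>i. i \<in> I \<Longrightarrow> has_laplacian_at (u i) x (L i)"
  shows "has_laplacian_at (\<lambda>y. \<Sum>i\<in>I. u i y) x (\<Sum>i\<in>I. L i)"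
  using assms
  by (induction I rule: infinite_finite_induct)
    (auto intro: has_laplacian_at_const has_laplacian_at_add)

lemma has_laplacian_at_diff:
  assumes "has_laplacian_at u x L" "has_laplacian_at w x K"
  shows "has_laplacian_at (\<lambda>y. u y - w y) x (L - K)"
  using has_laplacian_at_add[OF assms(1) has_laplacian_at_cmult[OF assms(2), of "-1"]] by simp

text \<open>The exact Laplacian has the additional nonnegative term \<open>exp u |\<nabla>u|\<^sup>2\<close>; only its sign matters.\<close>
lemma has_laplacian_at_exp:
  assumes "has_laplacian_at u x L"
  obtains K where "has_laplacian_at (\<lambda>y. exp (u y)) x K" "exp (u x) * L \<le> K"
proof -
  obtain u1 u2 where u: "L = (\<Sum>b\<in>Basis. u2 b)"
    "\<And>b. b \<in> Basis \<Longrightarrow>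
      \<forall>\<^sub>F t in nhds 0. ((\<lambda>s. u (x + s *\<^sub>R b)) has_real_derivative u1 b t) (at t)"
    "\<And>b. b \<in> Basis \<Longrightarrow> (u1 b has_real_derivative u2 b) (at 0)"
    using assms(1) unfolding has_laplacian_at_def by blast
  show ?thesis
  proof (rule that[OF has_laplacian_atI])
    fix b :: 'a assume b: "b \<in> Basis"
    show "\<forall>\<^sub>F t in nhds 0. ((\<lambda>s. exp (u (x + s *\<^sub>R b)))
        has_real_derivative exp (u (x + t *\<^sub>R b)) * u1 b t) (at t)"
      using u(2)[OF b] by eventually_elim (rule DERIV_fun_exp)
    have "((\<lambda>s. u (x + s *\<^sub>R b)) has_real_derivative u1 b 0) (at 0)"
      using u(2)[OF b] by (rule eventually_nhds_x_imp_x)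
    then show "((\<lambda>t. exp (u (x + t *\<^sub>R b)) * u1 b t) has_real_derivative
        exp (u x) * ((u1 b 0)\<^sup>2 + u2 b)) (at 0)"
      using u(3)[OF b] by (auto intro!: derivative_eq_intros simp: field_simps power2_eq_square)
  next
    show "exp (u x) * L \<le> (\<Sum>b\<in>Basis. exp (u x) * ((u1 b 0)\<^sup>2 + u2 b))"
      unfolding u(1) sum_distrib_left by (intro sum_mono) simp
  qed (rule refl)
qed

text \<open>Were \<open>D\<close> positive, \<open>f1\<close>, which vanishes at the maximum, would
  be positive just to its right, and the mean value theorem would lift \<open>f\<close> above
  \<open>f 0\<close> there.\<close>

lemma second_derivative_local_max:
  fixes f f1 :: "real \<Rightarrow> real"
  assumes "\<forall>\<^sub>F t in nhds 0. (f has_real_derivative f1 t) (at t)"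
    and "(f1 has_real_derivative D) (at 0)"
    and "\<forall>\<^sub>F t in nhds 0. f t \<le> f 0"
  shows "D \<le> 0"
proof (rule ccontr)
  assume "\<not> D \<le> 0"
  then have D: "D > 0" by simp
  obtain d1 where d1: "d1 > 0" "\<And>t. \<bar>t\<bar> < d1 \<Longrightarrow> (f has_real_derivative f1 t) (at t)"
    using assms(1) by (auto simp: eventually_nhds_metric dist_real_def)
  obtain d2 where d2: "d2 > 0" "\<And>t. \<bar>t\<bar> < d2 \<Longrightarrow> f t \<le> f 0"
    using assms(3) by (auto simp: eventually_nhds_metric dist_real_def)
  obtain d3 where d3: "d3 > 0" "\<And>h. 0 < h \<Longrightarrow> h < d3 \<Longrightarrow> f1 0 < f1 h"
    using DERIV_pos_inc_right[OF assms(2) D] by auto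
  have f10: "f1 0 = 0"
    using DERIV_local_max[of f "f1 0" 0 d2] d1 d2 by auto
  define e where "e = min d1 (min d2 d3) / 2"
  have e: "0 < e" "e < d1" "e < d2" "e < d3" using d1 d2 d3 by (auto simp: e_def)
  have "\<exists>t. 0 < t \<and> t < e \<and> f e - f 0 = (e - 0) * f1 t"
    using e d1(2) by (intro MVT2) auto
  then obtain t where t: "0 < t" "t < e" "f e - f 0 = e * f1 t" by auto
  have "f1 t > 0" using d3(2)[of t] t e f10 by auto
  then have "f e > f 0" using t(3) e(1) mult_pos_pos[of e "f1 t"] by linarith
  with d2(2)[of e] e show False by auto
qed

lemma has_laplacian_at_local_max:
  assumes "has_laplacian_at u x L" "\<forall>\<^sub>F y in nhds x. u y \<le> u x"
  shows "L \<le> 0"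
proof -
  obtain u1 u2 where u: "L = (\<Sum>b\<in>Basis. u2 b)"
    "\<And>b. b \<in> Basis \<Longrightarrow>
      \<forall>\<^sub>F t in nhds 0. ((\<lambda>s. u (x + s *\<^sub>R b)) has_real_derivative u1 b t) (at t)"
    "\<And>b. b \<in> Basis \<Longrightarrow> (u1 b has_real_derivative u2 b) (at 0)"
    using assms(1) unfolding has_laplacian_at_def by blast
  have "u2 b \<le> 0" if b: "b \<in> Basis" for b
  proof (rule second_derivative_local_max[OF u(2)[OF b] u(3)[OF b]])
    have "isCont (\<lambda>t::real. x + t *\<^sub>R b) 0" by (intro continuous_intros)
    then have "filterlim (\<lambda>t. x + t *\<^sub>R b) (nhds x) (nhds 0)"
      using tendsto_at_iff_tendsto_nhds[of "\<lambda>t. x + t *\<^sub>R b" 0] by (simp add: isCont_def)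
    from eventually_compose_filterlim[OF assms(2) this]
    show "\<forall>\<^sub>F t in nhds 0. u (x + t *\<^sub>R b) \<le> u (x + 0 *\<^sub>R b)" by simp
  qed
  then show ?thesis unfolding u(1) by (rule sum_nonpos)
qed

text \<open>The chain rule in the squared distance gives each coordinate second derivative, and
  Pythagoras sums them. It yields the Laplacians of the logarithms in \<open>f_bg\<close> and of the
  barrier.\<close>

lemma has_laplacian_at_radial:
  fixes x a :: "'a::euclidean_space"
  assumes "\<forall>\<^sub>F s in nhds ((norm (x - a))\<^sup>2). (\<Phi> has_real_derivative \<Phi>1 s) (at s)"
    and "(\<Phi>1 has_real_derivative D) (at ((norm (x - a))\<^sup>2))"
  shows "has_laplacian_at (\<lambda>y. \<Phi> ((norm (y - a))\<^sup>2)) x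
      (2 * real DIM('a) * \<Phi>1 ((norm (x - a))\<^sup>2) + 4 * (norm (x - a))\<^sup>2 * D)"
proof (rule has_laplacian_atI)
  fix b :: 'a assume b: "b \<in> Basis"
  \<comment> \<open>The squared distance along a line is a polynomial, hence differentiable also
    when \<open>x = a\<close>.\<close>
  define p where "p = (\<lambda>s. (norm (x - a))\<^sup>2 + 2 * s * ((x - a) \<bullet> b) + s\<^sup>2)"
  have p: "(norm (x + s *\<^sub>R b - a))\<^sup>2 = p s" for s
  proof -
    have "x + s *\<^sub>R b - a = (x - a) + s *\<^sub>R b" by simp
    then have "(norm (x + s *\<^sub>R b - a))\<^sup>2 = ((x - a) + s *\<^sub>R b) \<bullet> ((x - a) + s *\<^sub>R b)"
      by (simp only: power2_norm_eq_inner)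
    also have "\<dots> = (x - a) \<bullet> (x - a) + 2 * s * ((x - a) \<bullet> b) + s\<^sup>2"
      using b by (simp add: inner_add_left inner_add_right inner_commute[of b "x - a"]
          power2_eq_square distrib_left del: inner_diff_left inner_diff_right)
    finally show ?thesis unfolding p_def power2_norm_eq_inner .
  qed
  have dp: "(p has_real_derivative 2 * ((x - a) \<bullet> b) + 2 * t) (at t)" for t
    unfolding p_def by (auto intro!: derivative_eq_intros)
  have "isCont p 0" using DERIV_isCont[OF dp] .
  then have "filterlim p (nhds (p 0)) (nhds 0)"
    unfolding isCont_def tendsto_at_iff_tendsto_nhds .
  moreover have p0: "p 0 = (norm (x - a))\<^sup>2" by (simp add: p_def)
  ultimately have "\<forall>\<^sub>F t in nhds 0. (\<Phi> has_real_derivative \<Phi>1 (p t)) (at (p t))"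
    using eventually_compose_filterlim[OF assms(1), of p "nhds 0"] by simp
  then show "\<forall>\<^sub>F t in nhds 0. ((\<lambda>s. \<Phi> ((norm (x + s *\<^sub>R b - a))\<^sup>2)) has_real_derivative
      \<Phi>1 (p t) * (2 * ((x - a) \<bullet> b) + 2 * t)) (at t)"
    unfolding p by eventually_elim (rule DERIV_chain2[OF _ dp])
  have "((\<lambda>t. \<Phi>1 (p t)) has_real_derivative D * (2 * ((x - a) \<bullet> b) + 2 * 0)) (at 0)"
    by (rule DERIV_chain2[OF _ dp]) (use assms(2) p0 in simp)
  then show "((\<lambda>t. \<Phi>1 (p t) * (2 * ((x - a) \<bullet> b) + 2 * t)) has_real_derivative
      2 * \<Phi>1 ((norm (x - a))\<^sup>2) + 4 * D * ((x - a) \<bullet> b)\<^sup>2) (at 0)"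
    by (auto intro!: derivative_eq_intros simp: p0 power2_eq_square)
next
  have "(norm (x - a))\<^sup>2 = (\<Sum>b\<in>Basis. ((x - a) \<bullet> b)\<^sup>2)"
    unfolding power2_norm_eq_inner by (subst euclidean_inner) (simp add: power2_eq_square)
  then show "2 * real DIM('a) * \<Phi>1 ((norm (x - a))\<^sup>2) + 4 * (norm (x - a))\<^sup>2 * D
      = (\<Sum>b\<in>Basis. 2 * \<Phi>1 ((norm (x - a))\<^sup>2) + 4 * D * ((x - a) \<bullet> b)\<^sup>2)"
    by (simp add: sum.distrib sum_distrib_left algebra_simps)
qed

lemma differentiable_has_partial_deriv:
  assumes "u differentiable_on UNIV"
  shows "((\<lambda>s. u (x + s *\<^sub>R b)) has_real_derivative partial_deriv b u (x + t *\<^sub>R b)) (at t)"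
proof -
  have "((\<lambda>s. u (y + s *\<^sub>R b)) has_real_derivative partial_deriv b u y) (at 0)" for y
  proof -
    obtain D where D: "(u has_derivative D) (at y)"
      using assms unfolding differentiable_on_def differentiable_def by auto
    have "((\<lambda>s::real. y + s *\<^sub>R b) has_derivative (\<lambda>s. s *\<^sub>R b)) (at 0)"
      by (auto intro!: derivative_eq_intros)
    from has_derivative_compose[OF this, of u D] D
    have "((\<lambda>s. u (y + s *\<^sub>R b)) has_derivative (\<lambda>s. D (s *\<^sub>R b))) (at 0)" by simp
    then have "(\<lambda>s. u (y + s *\<^sub>R b)) differentiable at 0" unfolding differentiable_def by blast
    then show ?thesis unfolding partial_deriv_def DERIV_deriv_iff_real_differentiable .
  qed
  \<comment> \<open>\<open>partial_deriv\<close> differentiates at parameter 0; the derivative at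
    \<open>t\<close> is the one at 0 from the shifted base point.\<close>
  from this[of "x + t *\<^sub>R b"] show ?thesis
    using DERIV_shift[of "\<lambda>s. u (x + s *\<^sub>R b)" _ 0 t] by (simp add: algebra_simps)
qed

lemma C_2_has_laplacian_at:
  assumes "C_k 2 u"
  shows "has_laplacian_at u x (laplacian u x)"
proof (rule has_laplacian_atI)
  fix b :: 'a assume b: "b \<in> Basis"
  have d: "u differentiable_on UNIV" "partial_deriv b u differentiable_on UNIV"
    using assms b by (auto simp: numeral_2_eq_2)
  show "\<forall>\<^sub>F t in nhds 0. ((\<lambda>s. u (x + s *\<^sub>R b)) has_real_derivative partial_deriv b u (x + t *\<^sub>R b)) (at t)"
    using differentiable_has_partial_deriv[OF d(1)] by simp
  show "((\<lambda>t. partial_deriv b u (x + t *\<^sub>R b)) has_real_derivative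
      partial_deriv b (partial_deriv b u) x) (at 0)"
    using differentiable_has_partial_deriv[OF d(2), of x b 0] by simp
qed (simp add: laplacian_def)

text \<open>Outside a large ball \<open>u\<close> stays below \<open>u y\<close>, so the maximum
  over the ball is global. It supplies the maximum points for the contradiction arguments on the
  whole plane.\<close>

lemma attains_max_above_limit:
  fixes u :: "'a::euclidean_space \<Rightarrow> real"
  assumes "continuous_on UNIV u" "(u \<longlongrightarrow> c) at_infinity" "u y > c"
  obtains x where "\<And>y. u y \<le> u x" "u x > c"
proof -
  have "\<forall>\<^sub>F x in at_infinity. u x < u y"
    using order_tendstoD(2)[OF assms(2,3)] .
  then obtain R where R: "\<And>x. norm x \<ge> R \<Longrightarrow> u x < u y"
    unfolding eventually_at_infinity by auto
  have "y \<in> cball 0 R" using R[of y] by (force simp: dist_norm)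
  then obtain x where x: "x \<in> cball 0 R" "\<And>w. w \<in> cball 0 R \<Longrightarrow> u w \<le> u x"
    using continuous_attains_sup[of "cball 0 R" u] assms(1)
    by (metis compact_cball continuous_on_subset empty_iff subset_UNIV)
  have "u w \<le> u x" for w
    using x(2)[of w] x(2)[OF \<open>y \<in> cball 0 R\<close>] R[of w] by (cases "norm w \<le> R") (auto simp: dist_norm)
  moreover have "u x > c" using x(2)[OF \<open>y \<in> cball 0 R\<close>] assms(3) by simp
  ultimately show ?thesis using that by blast
qed

section \<open>Green's identity\<close>

lemma continuous_compact_support_integrable:
  fixes u :: "'a::euclidean_space \<Rightarrow> real"
  assumes "continuous_on UNIV u" "\<And>x. norm x > R \<Longrightarrow> u x = 0"
  shows "integrable lborel u"
proof -
  have "integrable lborel (\<lambda>x. indicator (cball 0 R) x *\<^sub>R u x)"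
    using assms(1) by (intro borel_integrable_compact) (auto intro: continuous_on_subset)
  also have "(\<lambda>x. indicator (cball 0 R) x *\<^sub>R u x) = u"
    using assms(2) by (auto simp: indicator_def fun_eq_iff dist_norm)
  finally show ?thesis .
qed

lemma lborel_integral_translation:
  fixes u :: "'a::euclidean_space \<Rightarrow> real"
  assumes "u \<in> borel_measurable borel"
  shows "(LINT x|lborel. u (x + c)) = (LINT x|lborel. u x)"
proof -
  have "(LINT x|lborel. u x) = (LINT x|distr lborel borel ((+) c). u x)"
    by (simp add: lborel_distr_plus)
  also have "\<dots> = (LINT x|lborel. u (c + x))"
    using assms by (subst integral_distr) auto
  finally show ?thesis by (simp add: add.commute)
qed

text \<open>By translation invariance all difference quotients have integral zero.\<close>
lemma integral_directional_derivative_eq_0: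
  fixes u u' :: "'a::euclidean_space \<Rightarrow> real"
  assumes du: "\<And>x t. ((\<lambda>s. u (x + s *\<^sub>R b)) has_real_derivative u' (x + t *\<^sub>R b)) (at t)"
    and b: "norm b = 1"
    and cu: "continuous_on UNIV u" and cu': "continuous_on UNIV u'"
    and supp: "\<And>x. norm x > R \<Longrightarrow> u x = 0" and supp': "\<And>x. norm x > R \<Longrightarrow> u' x = 0"
  shows "(LINT x|lborel. u' x) = 0"
proof -
  obtain M where M: "\<And>x. \<bar>u' x\<bar> \<le> M" "M \<ge> 0"
  proof -
    have "compact (u' ` cball 0 R)"
      using cu' by (intro compact_continuous_image) (auto intro: continuous_on_subset)
    then obtain M where "\<forall>x\<in>cball 0 R. \<bar>u' x\<bar> \<le> M"
      by (auto dest!: compact_imp_bounded simp: bounded_iff)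
    then have "\<bar>u' x\<bar> \<le> max M 0" for x
      using supp'[of x] by (cases "norm x \<le> R") (force simp: le_max_iff_disj)+
    then show ?thesis using that[of "max M 0"] by simp
  qed
  \<comment> \<open>Steps of length at most 1 keep the supports of all difference quotients in the
    ball of radius \<open>R + 1\<close>, where \<open>M\<close> dominates them by the mean value
    theorem.\<close>
  define h where "h = (\<lambda>k. inverse (real (Suc k)))"
  have h: "0 < h k" "h k \<le> 1" for k by (auto simp: h_def field_simps)
  define Q where "Q = (\<lambda>k x. (u (x + h k *\<^sub>R b) - u x) / h k)"
  have mu: "u \<in> borel_measurable borel" and mu': "u' \<in> borel_measurable borel"
    using cu cu' by (auto intro: borel_measurable_continuous_onI)
  have iu: "integrable lborel u" using cu supp by (rule continuous_compact_support_integrable)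
  have Qbound: "norm (Q k x) \<le> M * indicator (cball 0 (R + 1)) x" for k x
  proof (cases "norm x \<le> R + 1")
    case True
    have "\<exists>t>0. t < h k \<and> u (x + h k *\<^sub>R b) - u (x + 0 *\<^sub>R b) = (h k - 0) * u' (x + t *\<^sub>R b)"
      using h du by (intro MVT2) auto
    then obtain t where "Q k x = u' (x + t *\<^sub>R b)"
      using h[of k] by (auto simp: Q_def)
    then show ?thesis using True M by (simp add: dist_norm)
  next
    case False
    have "norm x \<le> norm (x + h k *\<^sub>R b) + norm (h k *\<^sub>R b)"
      using norm_triangle_ineq4[of "x + h k *\<^sub>R b" "h k *\<^sub>R b"] by simp
    then have "norm (x + h k *\<^sub>R b) > R" using False b h[of k] by simp
    then show ?thesis using False supp by (simp add: Q_def)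
  qed
  have "(\<lambda>k. LINT x|lborel. Q k x) \<longlonglongrightarrow> (LINT x|lborel. u' x)"
  proof (rule integral_dominated_convergence[where w="\<lambda>x. M * indicator (cball 0 (R + 1)) x"])
    show "u' \<in> borel_measurable lborel" using mu' by simp
    show "Q k \<in> borel_measurable lborel" for k
      unfolding Q_def using mu by measurable
    show "integrable lborel (\<lambda>x::'a. M * indicator (cball 0 (R + 1)) x :: real)"
      using emeasure_bounded_finite[of "cball (0::'a) (R + 1)"]
      by (intro integrable_mult_right integrable_real_indicator) auto
    have "(\<lambda>k. Q k x) \<longlonglongrightarrow> u' x" for x
    proof -
      have "((\<lambda>s. (u (x + s *\<^sub>R b) - u x) / s) \<longlongrightarrow> u' x) (at 0)"
        using du[of x 0] by (simp add: DERIV_def)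
      moreover have "filterlim h (at 0) sequentially"
        unfolding h_def filterlim_at
        by (auto intro!: LIMSEQ_inverse_real_of_nat simp del: of_nat_Suc)
      ultimately show ?thesis unfolding Q_def by (rule filterlim_compose)
    qed
    then show "AE x in lborel. (\<lambda>k. Q k x) \<longlonglongrightarrow> u' x" by simp
  qed (use Qbound in simp)
  moreover have "(LINT x|lborel. Q k x) = 0" for k
  proof -
    have "integrable lborel (\<lambda>x. u (x + h k *\<^sub>R b))"
    proof (rule continuous_compact_support_integrable[where R="R + 1"])
      show "continuous_on UNIV (\<lambda>x. u (x + h k *\<^sub>R b))"
        by (intro continuous_on_compose2[OF cu] continuous_intros) auto
      fix x :: 'a assume "norm x > R + 1"
      moreover have "norm x \<le> norm (x + h k *\<^sub>R b) + norm (h k *\<^sub>R b)"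
        using norm_triangle_ineq4[of "x + h k *\<^sub>R b" "h k *\<^sub>R b"] by simp
      ultimately have "norm (x + h k *\<^sub>R b) > R" using b h[of k] by simp
      then show "u (x + h k *\<^sub>R b) = 0" by (rule supp)
    qed
    then show ?thesis
      unfolding Q_def using iu lborel_integral_translation[OF mu, of "h k *\<^sub>R b"] by simp
  qed
  ultimately show ?thesis by (simp add: LIMSEQ_const_iff)
qed

lemma C_2_continuous:
  assumes "C_k 2 u"
  shows "continuous_on UNIV u"
    and "b \<in> Basis \<Longrightarrow> continuous_on UNIV (partial_deriv b u)"
    and "b \<in> Basis \<Longrightarrow> continuous_on UNIV (partial_deriv b (partial_deriv b u))"
    and "continuous_on UNIV (laplacian u)"
proof -
  have u: "u differentiable_on UNIV" "\<And>b. b \<in> Basis \<Longrightarrow> partial_deriv b u differentiable_on UNIV"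
    "\<And>b. b \<in> Basis \<Longrightarrow> continuous_on UNIV (partial_deriv b (partial_deriv b u))"
    using assms by (auto simp: numeral_2_eq_2)
  then show "continuous_on UNIV u" "b \<in> Basis \<Longrightarrow> continuous_on UNIV (partial_deriv b u)"
    "b \<in> Basis \<Longrightarrow> continuous_on UNIV (partial_deriv b (partial_deriv b u))"
    by (auto intro: differentiable_imp_continuous_on)
  have "laplacian u = (\<lambda>x. \<Sum>b\<in>Basis. partial_deriv b (partial_deriv b u) x)"
    by (rule ext) (rule laplacian_def)
  then show "continuous_on UNIV (laplacian u)"
    using u(3) by (auto intro!: continuous_on_sum)
qed

lemma partial_deriv_eq_0:
  fixes u :: "'a::euclidean_space \<Rightarrow> real"
  assumes "\<And>x. norm x > R \<Longrightarrow> u x = 0" "norm x > R"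
  shows "partial_deriv b u x = 0"
proof -
  have "isCont (\<lambda>t::real. norm (x + t *\<^sub>R b)) 0" by (intro continuous_intros)
  then have "((\<lambda>t::real. norm (x + t *\<^sub>R b)) \<longlongrightarrow> norm (x + 0 *\<^sub>R b)) (nhds 0)"
    using tendsto_at_iff_tendsto_nhds[of "\<lambda>t. norm (x + t *\<^sub>R b)" 0] by (simp add: isCont_def)
  then have "\<forall>\<^sub>F t in nhds 0. norm (x + t *\<^sub>R b) > R"
    by (rule order_tendstoD(1)) (use assms(2) in simp)
  then have "\<forall>\<^sub>F t in nhds 0. u (x + t *\<^sub>R b) = 0"
    by eventually_elim (rule assms(1))
  then have "deriv (\<lambda>t. u (x + t *\<^sub>R b)) 0 = deriv (\<lambda>t. 0) 0"
    by (intro deriv_cong_ev) auto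
  then show ?thesis by (simp add: partial_deriv_def)
qed

lemma laplacian_eq_0:
  fixes u :: "'a::euclidean_space \<Rightarrow> real"
  assumes "\<And>x. norm x > R \<Longrightarrow> u x = 0" "norm x > R"
  shows "laplacian u x = 0"
  unfolding laplacian_def
  by (intro sum.neutral ballI partial_deriv_eq_0[where R=R] assms)

text \<open>In each direction \<open>b\<close> the function w d_b u - u d_b w has derivative w d_bb
  u - u d_bb w, the mixed products cancelling. The support of \<open>w\<close> confines these
  functions, so \<open>integral_directional_derivative_eq_0\<close> applies; then sum over
  \<open>b\<close>.\<close>

lemma green_identity:
  fixes u w :: "'a::euclidean_space \<Rightarrow> real"
  assumes u: "C_k 2 u" and w: "C_k 2 w" and supp: "\<And>x. norm x > R \<Longrightarrow> w x = 0"
  shows "(LINT x|lborel. laplacian u x * w x) = (LINT x|lborel. u x * laplacian w x)"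
proof -
  note cu = C_2_continuous[OF u] and cw = C_2_continuous[OF w]
  have zero: "(LINT x|lborel. w x * partial_deriv b (partial_deriv b u) x
      - u x * partial_deriv b (partial_deriv b w) x) = 0"
    if b: "b \<in> Basis" for b
  proof (rule integral_directional_derivative_eq_0[where b=b and R=R])
    have d: "u differentiable_on UNIV" "partial_deriv b u differentiable_on UNIV"
      "w differentiable_on UNIV" "partial_deriv b w differentiable_on UNIV"
      using u w b by (auto simp: numeral_2_eq_2)
    note d = d[THEN differentiable_has_partial_deriv]
    show "((\<lambda>s. w (x + s *\<^sub>R b) * partial_deriv b u (x + s *\<^sub>R b)
        - u (x + s *\<^sub>R b) * partial_deriv b w (x + s *\<^sub>R b)) has_real_derivative
        w (x + t *\<^sub>R b) * partial_deriv b (partial_deriv b u) (x + t *\<^sub>R b)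
      - u (x + t *\<^sub>R b) * partial_deriv b (partial_deriv b w) (x + t *\<^sub>R b)) (at t)" for x t
      by (rule derivative_eq_intros d refl)+ simp
    show "continuous_on UNIV (\<lambda>x. w x * partial_deriv b u x - u x * partial_deriv b w x)"
      "continuous_on UNIV (\<lambda>x. w x * partial_deriv b (partial_deriv b u) x
        - u x * partial_deriv b (partial_deriv b w) x)"
      using cu cw b by (auto intro!: continuous_intros)
    fix x :: 'a assume x: "norm x > R"
    show "w x * partial_deriv b u x - u x * partial_deriv b w x = 0"
      "w x * partial_deriv b (partial_deriv b u) x
        - u x * partial_deriv b (partial_deriv b w) x = 0"
      using x supp partial_deriv_eq_0[of R w, OF supp]
        partial_deriv_eq_0[of R "partial_deriv b w", OF partial_deriv_eq_0[of R w, OF supp]]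
      by auto
  qed (use b in simp)
  have int: "integrable lborel (\<lambda>x. w x * partial_deriv b (partial_deriv b u) x
      - u x * partial_deriv b (partial_deriv b w) x)" if b: "b \<in> Basis" for b
  proof (rule continuous_compact_support_integrable[where R=R])
    show "continuous_on UNIV (\<lambda>x. w x * partial_deriv b (partial_deriv b u) x
        - u x * partial_deriv b (partial_deriv b w) x)"
      using cu cw b by (auto intro!: continuous_intros)
    show "w x * partial_deriv b (partial_deriv b u) x
        - u x * partial_deriv b (partial_deriv b w) x = 0" if x: "norm x > R" for x
      using x supp
        partial_deriv_eq_0[of R "partial_deriv b w", OF partial_deriv_eq_0[of R w, OF supp]]
      by auto
  qed
  have "(LINT x|lborel. laplacian u x * w x - u x * laplacian w x)
      = (LINT x|lborel. (\<Sum>b\<in>Basis. w x * partial_deriv b (partial_deriv b u) x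
          - u x * partial_deriv b (partial_deriv b w) x))"
    by (simp add: laplacian_def sum_subtractf sum_distrib_left mult.commute)
  also have "\<dots> = 0"
    using int by (subst Bochner_Integration.integral_sum) (auto simp: zero)
  finally have "(LINT x|lborel. laplacian u x * w x - u x * laplacian w x) = 0" .
  moreover have "integrable lborel (\<lambda>x. laplacian u x * w x)"
    using supp cu cw
    by (intro continuous_compact_support_integrable[where R=R] continuous_intros) auto
  moreover have "integrable lborel (\<lambda>x. u x * laplacian w x)"
    using laplacian_eq_0[of R w, OF supp] cu cw
    by (intro continuous_compact_support_integrable[where R=R] continuous_intros) auto
  ultimately show ?thesis by simp
qed

section \<open>Truncated powers and a twice continuously differentiable cutoff\<close>

lemma DERIV_max_0_power:
  "((\<lambda>t::real. max 0 t ^ Suc (Suc k)) has_real_derivative real (Suc (Suc k)) * max 0 t ^ Suc k) (at t)"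
proof -
  consider "t > 0" | "t < 0" | "t = 0" by linarith
  then show ?thesis
  proof cases
    case 1
    have "((\<lambda>t::real. t ^ Suc (Suc k)) has_real_derivative real (Suc (Suc k)) * t ^ Suc k) (at t)"
      using DERIV_pow[of "Suc (Suc k)" t] by simp
    moreover have "\<forall>\<^sub>F s in nhds t. s ^ Suc (Suc k) = max 0 s ^ Suc (Suc k)"
      using eventually_nhds_in_open[of "{0<..}" t] 1 by (auto elim!: eventually_mono)
    ultimately show ?thesis using 1
      by (subst (asm) DERIV_cong_ev[OF refl _ refl]) (auto simp: max_def)
  next
    case 2
    have "((\<lambda>t::real. 0) has_real_derivative 0) (at t)" by simp
    moreover have "\<forall>\<^sub>F s in nhds t. 0 = max 0 s ^ Suc (Suc k)"
      using eventually_nhds_in_open[of "{..<0}" t] 2 by (auto elim!: eventually_mono)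
    ultimately show ?thesis using 2
      by (subst (asm) DERIV_cong_ev[OF refl _ refl]) (auto simp: max_def)
  next
    case 3
    \<comment> \<open>At the kink the difference quotient is at most |h|^(k+1), which tends to 0;
      hence exponents start at 2.\<close>
    have "((\<lambda>h::real. max 0 h ^ Suc (Suc k) / h) \<longlongrightarrow> 0) (at 0)"
    proof (rule Lim_null_comparison)
      have "norm (max 0 h ^ Suc (Suc k) / h) \<le> \<bar>h\<bar> ^ Suc k" for h :: real
      proof (cases "h > 0")
        case False
        then have "max 0 h = 0" by simp
        show ?thesis unfolding \<open>max 0 h = 0\<close> by simp
      qed (simp add: max_def)
      then show "\<forall>\<^sub>F h in at 0. norm (max 0 h ^ Suc (Suc k) / h) \<le> \<bar>h\<bar> ^ Suc k" for h :: real
        by simp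
      have "isCont (\<lambda>h::real. \<bar>h\<bar> ^ Suc k) 0" by (intro continuous_intros)
      then show "((\<lambda>h::real. \<bar>h\<bar> ^ Suc k) \<longlongrightarrow> 0) (at 0)" by (simp add: isCont_def)
    qed
    then show ?thesis using 3 by (simp add: DERIV_def)
  qed
qed

lemma has_derivative_radial:
  fixes x :: "'a::euclidean_space"
  assumes "\<And>s. (\<Phi> has_real_derivative \<Phi>1 s) (at s)"
  shows "((\<lambda>y. \<Phi> (y \<bullet> y)) has_derivative (\<lambda>k. 2 * (x \<bullet> k) * \<Phi>1 (x \<bullet> x))) (at x)"
proof -
  have "((\<lambda>y. y \<bullet> y) has_derivative (\<lambda>k. 2 * (x \<bullet> k))) (at x)"
    by (auto intro!: derivative_eq_intros simp: inner_commute)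
  from has_derivative_compose[OF this assms[of "x \<bullet> x", unfolded has_field_derivative_def]]
  show ?thesis by (simp add: mult.commute)
qed

lemma partial_deriv_eq:
  assumes "(u has_derivative D) (at x)"
  shows "partial_deriv b u x = D b"
proof -
  have "((\<lambda>s::real. x + s *\<^sub>R b) has_derivative (\<lambda>s. s *\<^sub>R b)) (at 0)"
    by (auto intro!: derivative_eq_intros)
  from has_derivative_compose[OF this, of u D] assms
  have "((\<lambda>s. u (x + s *\<^sub>R b)) has_derivative (\<lambda>s. D (s *\<^sub>R b))) (at 0)" by simp
  moreover have "(\<lambda>s. D (s *\<^sub>R b)) = (\<lambda>s. D b * s)"
    using linear_scale[OF has_derivative_linear[OF assms]] by (simp add: mult.commute)
  ultimately have "((\<lambda>s. u (x + s *\<^sub>R b)) has_real_derivative D b) (at 0)"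
    by (simp add: has_field_derivative_def)
  then show ?thesis unfolding partial_deriv_def by (rule DERIV_imp_deriv)
qed

text \<open>\<open>C_k\<close> asks for full differentiability, so derivatives along lines as in
  \<open>has_laplacian_at_radial\<close> do not suffice; the first and second partial derivatives
  are computed from total derivatives.\<close>

lemma C_2_radial:
  fixes \<Phi> \<Phi>1 \<Phi>2 :: "real \<Rightarrow> real"
  assumes d1: "\<And>s. (\<Phi> has_real_derivative \<Phi>1 s) (at s)"
    and d2: "\<And>s. (\<Phi>1 has_real_derivative \<Phi>2 s) (at s)"
    and c: "continuous_on UNIV \<Phi>2"
  shows "C_k 2 (\<lambda>x::'a::euclidean_space. \<Phi> (x \<bullet> x))"
proof -
  have p: "partial_deriv b (\<lambda>x::'a. \<Phi> (x \<bullet> x)) = (\<lambda>x. 2 * (x \<bullet> b) * \<Phi>1 (x \<bullet> x))" for b :: 'a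
    by (rule ext) (rule partial_deriv_eq[OF has_derivative_radial[OF d1]])
  have d: "((\<lambda>x::'a. 2 * (x \<bullet> b) * \<Phi>1 (x \<bullet> x)) has_derivative
      (\<lambda>k. 2 * (x \<bullet> b) * (2 * (x \<bullet> k) * \<Phi>2 (x \<bullet> x)) + 2 * (k \<bullet> b) * \<Phi>1 (x \<bullet> x))) (at x)" for b x
    by (rule has_derivative_mult[OF _ has_derivative_radial[OF d2]])
      (auto intro!: derivative_eq_intros)
  have p2: "partial_deriv c (\<lambda>x::'a. 2 * (x \<bullet> b) * \<Phi>1 (x \<bullet> x)) =
     (\<lambda>x. 2 * (x \<bullet> b) * (2 * (x \<bullet> c) * \<Phi>2 (x \<bullet> x)) + 2 * (c \<bullet> b) * \<Phi>1 (x \<bullet> x))" for b c :: 'a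
    by (rule ext) (rule partial_deriv_eq[OF d])
  have c1: "continuous_on UNIV \<Phi>1"
    using DERIV_isCont[OF d2] by (simp add: continuous_on_eq_continuous_within)
  have "(\<lambda>x::'a. \<Phi> (x \<bullet> x)) differentiable_on UNIV"
    "(\<lambda>x::'a. 2 * (x \<bullet> b) * \<Phi>1 (x \<bullet> x)) differentiable_on UNIV" for b
    using has_derivative_radial[OF d1] d unfolding differentiable_on_def differentiable_def by auto
  moreover have "continuous_on UNIV (\<lambda>x. 2 * (x \<bullet> b) * (2 * (x \<bullet> c) * \<Phi>2 (x \<bullet> x))
      + 2 * (c \<bullet> b) * \<Phi>1 (x \<bullet> x))" for b c :: 'a
    by (intro continuous_intros continuous_on_compose2[OF c] continuous_on_compose2[OF c1]) auto
  ultimately show ?thesis by (simp add: numeral_2_eq_2 p p2)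
qed

text \<open>Green's identity asks for \<open>C_k 2\<close> only, so the cube of the positive part of
  R^2 + 1 - |x|^2 serves as cutoff: that base is at least 1 on the ball of radius \<open>R\<close>
  and negative beyond radius \<open>R + 1\<close>. The factor \<open>M\<close> lets the cutoff
  majorize a bounded test function.\<close>

lemma cutoff_exists:
  fixes R M :: real
  assumes "R \<ge> 0" "M \<ge> 0"
  obtains w :: "'a::euclidean_space \<Rightarrow> real" and S :: real where "C_k 2 w" "\<And>x. w x \<ge> 0"
    "\<And>x. norm x > S \<Longrightarrow> w x = 0" "\<And>x. norm x \<le> R \<Longrightarrow> M \<le> w x"
proof
  define \<Phi> where "\<Phi> = (\<lambda>s::real. M * max 0 (R\<^sup>2 + 1 - s) ^ 3)"
  have n: "R\<^sup>2 \<ge> x \<bullet> x" if "norm x \<le> R" for x :: 'a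
    using power_mono[OF that norm_ge_zero, of 2] by (simp add: power2_norm_eq_inner)
  have n': "R\<^sup>2 + 1 \<le> x \<bullet> x" if "norm x > R + 1" for x :: 'a
    using power_mono[of "R + 1" "norm x" 2] assms that
    by (simp add: power2_norm_eq_inner power2_sum)
  show "C_k 2 (\<lambda>x::'a. \<Phi> (x \<bullet> x))"
  proof (rule C_2_radial)
    have d: "((\<lambda>s. R\<^sup>2 + 1 - s) has_real_derivative - 1) (at s)" for s
      by (auto intro!: derivative_eq_intros)
    show "(\<Phi> has_real_derivative M * (- 3 * max 0 (R\<^sup>2 + 1 - s) ^ 2)) (at s)" for s
      unfolding \<Phi>_def using DERIV_chain2[OF DERIV_max_0_power[of 1] d]
      by (intro DERIV_cmult) (simp add: numeral_eq_Suc)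
    show "((\<lambda>s. M * (- 3 * max 0 (R\<^sup>2 + 1 - s) ^ 2)) has_real_derivative
        M * (- 3 * (- 2 * max 0 (R\<^sup>2 + 1 - s)))) (at s)" for s
      using DERIV_chain2[OF DERIV_max_0_power[of 0] d]
      by (intro DERIV_cmult) (simp add: numeral_eq_Suc)
    show "continuous_on UNIV (\<lambda>s. M * (- 3 * (- 2 * max 0 (R\<^sup>2 + 1 - s))))"
      by (intro continuous_intros)
  qed
  show "\<Phi> (x \<bullet> x) \<ge> 0" for x :: 'a using assms by (simp add: \<Phi>_def)
  show "\<Phi> (x \<bullet> x) = 0" if "norm x > R + 1" for x :: 'a
    using n'[OF that] by (simp add: \<Phi>_def max_def)
  show "M \<le> \<Phi> (x \<bullet> x)" if "norm x \<le> R" for x :: 'a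
  proof -
    have "1 \<le> max 0 (R\<^sup>2 + 1 - x \<bullet> x) ^ 3"
      using n[OF that] by (intro one_le_power) auto
    then show ?thesis using mult_left_mono[OF _ assms(2), of 1] by (simp add: \<Phi>_def)
  qed
qed

section \<open>A priori bounds\<close>

text \<open>Each exp (n ln r) is the power r^n, and a positive exponent makes the product vanish at
  a vortex. The product form has no case distinction, so continuity through the vortices and the
  limit at infinity can be read off.\<close>

lemma exp_vf_eq:
  assumes "\<forall>j\<in>{1..m}. n j > 0"
  shows "exp_vf m z n v =
    (\<lambda>x. exp (v x) * (\<Prod>j=1..m. ((norm (x - z j))\<^sup>2 / (1 + (norm (x - z j))\<^sup>2)) ^ n j))"
proof
  fix x
  show "exp_vf m z n v x =
    exp (v x) * (\<Prod>j=1..m. ((norm (x - z j))\<^sup>2 / (1 + (norm (x - z j))\<^sup>2)) ^ n j)"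
  proof (cases "x \<in> z ` {1..m}")
  case True
  then obtain k where "k \<in> {1..m}" "x = z k" by auto
  then have "(\<Prod>j=1..m. ((norm (x - z j))\<^sup>2 / (1 + (norm (x - z j))\<^sup>2)) ^ n j) = 0"
    using assms by (intro prod_zero) auto
  then show ?thesis using True by (simp add: exp_vf_def)
next
  case False
  have "exp (real (n j) * ln ((norm (x - z j))\<^sup>2 / (1 + (norm (x - z j))\<^sup>2)))
      = ((norm (x - z j))\<^sup>2 / (1 + (norm (x - z j))\<^sup>2)) ^ n j" if "j \<in> {1..m}" for j
  proof -
    have "(norm (x - z j))\<^sup>2 > 0" using False that by auto
    then have "(norm (x - z j))\<^sup>2 / (1 + (norm (x - z j))\<^sup>2) > 0" by (simp add: add_pos_pos)
    then show ?thesis by (simp add: exp_of_nat_mult)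
  qed
  then show ?thesis using False by (simp add: exp_vf_def f_bg_def exp_add exp_sum)
  qed
qed

lemma exp_vf_nonneg: "exp_vf m z n v x \<ge> 0"
  by (simp add: exp_vf_def)

lemma exp_vf_continuous:
  assumes "\<forall>j\<in>{1..m}. n j > 0" "continuous_on S v"
  shows "continuous_on S (exp_vf m z n v)"
proof -
  have "1 + (norm (x - z j))\<^sup>2 \<noteq> 0" for x j
    using zero_le_power2[of "norm (x - z j)"] by linarith
  then show ?thesis
    unfolding exp_vf_eq[OF assms(1)] using assms(2)
    by (intro continuous_intros) auto
qed

lemma exp_vf_tendsto:
  assumes "\<forall>j\<in>{1..m}. n j > 0" "(v \<longlongrightarrow> 0) at_infinity"
  shows "(exp_vf m z n v \<longlongrightarrow> 1) at_infinity"
proof -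
  have "((\<lambda>x. (norm (x - a))\<^sup>2 / (1 + (norm (x - a))\<^sup>2)) \<longlongrightarrow> 1) at_infinity" for a :: plane
  proof -
    have "filterlim (\<lambda>x::plane. norm x - norm a) at_top at_infinity"
      using filterlim_tendsto_add_at_top[OF tendsto_const filterlim_norm_at_top, of "- norm a"]
      by (simp add: add.commute)
    then have "filterlim (\<lambda>x::plane. norm (x - a)) at_top at_infinity"
      by (rule filterlim_at_top_mono) (simp add: norm_triangle_ineq2)
    from filterlim_at_top_mult_at_top[OF this this]
    have sq: "filterlim (\<lambda>x::plane. (norm (x - a))\<^sup>2) at_top at_infinity"
      by (simp add: power2_eq_square)
    have "filterlim (\<lambda>x::plane. 1 + (norm (x - a))\<^sup>2) at_top at_infinity"
      by (rule filterlim_tendsto_add_at_top[OF tendsto_const sq])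
    then have "((\<lambda>x::plane. 1 - 1 / (1 + (norm (x - a))\<^sup>2)) \<longlongrightarrow> 1 - 0) at_infinity"
      by (intro tendsto_diff tendsto_const tendsto_divide_0[OF tendsto_const]
          filterlim_at_top_imp_at_infinity)
    moreover have "1 - 1 / (1 + s\<^sup>2) = s\<^sup>2 / (1 + s\<^sup>2)" for s :: real
      using zero_le_power2[of s] by (simp add: divide_simps add_nonneg_eq_0_iff)
    ultimately show ?thesis by simp
  qed
  then have "((\<lambda>x. exp (v x) * (\<Prod>j=1..m. ((norm (x - z j))\<^sup>2 / (1 + (norm (x - z j))\<^sup>2)) ^ n j))
      \<longlongrightarrow> exp 0 * (\<Prod>j=1..m. 1 ^ n j)) at_infinity"
    using assms(2) by (intro tendsto_intros)
  then show ?thesis unfolding exp_vf_eq[OF assms(1)] by simp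
qed

section \<open>The background functions and the maximum principle off the vortices\<close>

lemma f_bg_nonpos: "f_bg m z n x \<le> 0"
  unfolding f_bg_def
proof (intro sum_nonpos mult_nonneg_nonpos)
  fix j
  define s where "s = (norm (x - z j))\<^sup>2"
  have s: "s \<ge> 0" by (simp add: s_def)
  \<comment> \<open>The case \<open>s = 0\<close> is a vortex, where the convention
    \<open>ln 0 = 0\<close> keeps the bound.\<close>
  then show "ln ((norm (x - z j))\<^sup>2 / (1 + (norm (x - z j))\<^sup>2)) \<le> 0"
    unfolding s_def[symmetric] by (cases "s = 0") (auto simp: ln_le_zero_iff divide_simps)
qed simp

text \<open>Off the vortices ln s is harmonic in the plane, so only the -ln (1 + s) parts
  contribute. Hence the term g in the equation for \<open>v\<close> is exactly what passing from v
  to v + f removes.\<close>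

lemma f_bg_has_laplacian_at:
  assumes "x \<notin> z ` {1..m}"
  shows "has_laplacian_at (f_bg m z n) x (- g_bg m z n x)"
proof -
  have "has_laplacian_at (\<lambda>y. ln ((norm (y - z j))\<^sup>2 / (1 + (norm (y - z j))\<^sup>2))) x
      (- 4 / (1 + (norm (x - z j))\<^sup>2)\<^sup>2)" if j: "j \<in> {1..m}" for j
  proof -
    define s where "s = (norm (x - z j))\<^sup>2"
    have s: "s > 0" using assms j by (auto simp: s_def)
    have "\<forall>\<^sub>F t in nhds s. ((\<lambda>t. ln (t / (1 + t))) has_real_derivative 1 / t - 1 / (1 + t)) (at t)"
      using eventually_nhds_in_open[of "{0<..}" s] s
    proof (auto elim!: eventually_mono)
      fix t :: real assume "t > 0"
      then show "((\<lambda>t. ln (t / (1 + t))) has_real_derivative 1 / t - 1 / (1 + t)) (at t)"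
        by (auto intro!: derivative_eq_intros simp: divide_simps)
    qed
    moreover have "((\<lambda>t. 1 / t - 1 / (1 + t)) has_real_derivative - 1 / s\<^sup>2 + 1 / (1 + s)\<^sup>2) (at s)"
      using s by (auto intro!: derivative_eq_intros simp: power2_eq_square)
    ultimately have "has_laplacian_at (\<lambda>y. ln ((norm (y - z j))\<^sup>2 / (1 + (norm (y - z j))\<^sup>2))) x
        (2 * real DIM(plane) * (1 / s - 1 / (1 + s)) + 4 * s * (- 1 / s\<^sup>2 + 1 / (1 + s)\<^sup>2))"
      unfolding s_def by (rule has_laplacian_at_radial)
    also have "2 * real DIM(plane) * (1 / s - 1 / (1 + s)) + 4 * s * (- 1 / s\<^sup>2 + 1 / (1 + s)\<^sup>2)
        = - 4 / (1 + s)\<^sup>2"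
      using s by (simp add: divide_simps) algebra
    finally show ?thesis by (simp add: s_def)
  qed
  then have "has_laplacian_at (\<lambda>y. \<Sum>j=1..m. real (n j) *
      ln ((norm (y - z j))\<^sup>2 / (1 + (norm (y - z j))\<^sup>2))) x
      (\<Sum>j=1..m. real (n j) * (- 4 / (1 + (norm (x - z j))\<^sup>2)\<^sup>2))"
    by (intro has_laplacian_at_sum has_laplacian_at_cmult)
  then show ?thesis
    by (simp add: f_bg_def[abs_def] g_bg_def sum_negf mult.commute)
qed

lemma eventually_not_vortex:
  fixes z :: "nat \<Rightarrow> plane"
  assumes "x \<notin> z ` {1..m}"
  shows "\<forall>\<^sub>F y in nhds x. y \<notin> z ` {1..m}"
  using eventually_nhds_in_open[of "- z ` {1..m}" x] assms
  by (auto simp: open_Compl finite_imp_closed)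

text \<open>Near \<open>x\<close> there are no vortices, so v + f - G has a genuine local maximum
  there. \<open>G\<close> is 0 for the plain maximum principle and the barrier in the
  Keller--Osserman argument.\<close>

lemma laplacian_at_max:
  assumes "C_k 2 v" "x \<notin> z ` {1..m}" "has_laplacian_at G x K"
    and "\<forall>\<^sub>F y in nhds x. y \<notin> z ` {1..m} \<longrightarrow>
      v y + f_bg m z n y - G y \<le> v x + f_bg m z n x - G x"
  shows "laplacian v x - g_bg m z n x \<le> K"
proof -
  have "has_laplacian_at (\<lambda>y. v y + f_bg m z n y - G y) x
      (laplacian v x + - g_bg m z n x - K)"
    using assms
    by (intro has_laplacian_at_diff has_laplacian_at_add C_2_has_laplacian_at f_bg_has_laplacian_at)
  moreover have "\<forall>\<^sub>F y in nhds x. v y + f_bg m z n y - G y \<le> v x + f_bg m z n x - G x"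
    using assms(4) eventually_not_vortex[OF assms(2)] by eventually_elim simp
  ultimately have "laplacian v x + - g_bg m z n x - K \<le> 0"
    by (rule has_laplacian_at_local_max)
  then show ?thesis by simp
qed

text \<open>Keller--Osserman argument: a multiple of \<open>R\<^sup>2 / (R\<^sup>2 - r\<^sup>2)\<^sup>2\<close> is a supersolution on the disc
  of radius \<open>R\<close> which is infinite on its boundary and tends to \<open>0\<close> at its centre as \<open>R \<rightarrow> \<infinity>\<close>.\<close>
lemma abelian_higgs_exp_le_1:
  fixes w :: "plane \<Rightarrow> real"
  assumes n: "\<forall>j\<in>{1..m}. n j > 0" and w: "C_k 2 w" and q: "q > 0"
    and pde: "\<And>x. laplacian w x = 2 * q\<^sup>2 * (exp_vf m z n w x - 1) + g_bg m z n x"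
  shows "exp_vf m z n w a \<le> 1"
proof (rule ccontr)
  assume "\<not> exp_vf m z n w a \<le> 1"
  then have a: "a \<notin> z ` {1..m}" and ua: "w a + f_bg m z n a > 0"
    by (auto simp: exp_vf_def split: if_splits)
  define U where "U = w a + f_bg m z n a"
  \<comment> \<open>The constant 32 makes \<open>W\<close> a supersolution: it turns the bound on
    its Laplacian into q^2 W^2. The radius \<open>R\<close> is chosen so that
    \<open>W a = c / R^2 = U / 2\<close>, half the supposed positive value at the centre.\<close>
  define c where "c = 32 / q\<^sup>2"
  define R where "R = sqrt (2 * c / U)"
  have c: "c > 0" using q by (simp add: c_def)
  have R2: "R\<^sup>2 = 2 * c / U" and R: "R > 0"
    using c ua by (auto simp: R_def U_def)
  have cw: "continuous_on UNIV w" using C_2_continuous(1)[OF w] .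
  obtain M where M: "\<And>x. x \<in> cball a R \<Longrightarrow> w x \<le> M" "M \<ge> 0"
  proof -
    have "compact (w ` cball a R)"
      using cw by (intro compact_continuous_image) (auto intro: continuous_on_subset)
    then obtain M where M: "\<forall>x\<in>cball a R. \<bar>w x\<bar> \<le> M"
      by (auto dest!: compact_imp_bounded simp: bounded_iff)
    have "w x \<le> max M 0" if "x \<in> cball a R" for x using bspec[OF M that] by linarith
    then show ?thesis using that[of "max M 0"] by simp
  qed
  \<comment> \<open>\<open>W\<close> is singular at radius \<open>R\<close>, so the comparison takes
    place on a smaller disc. On the circle of radius \<open>r\<close> the barrier equals c (1 + k)^2
    / R^2, which is at least c k / R^2 = M.\<close>
  define k where "k = M * R\<^sup>2 / c"
  have k: "k \<ge> 0" using M c by (simp add: k_def)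
  define r where "r = sqrt (R\<^sup>2 - R\<^sup>2 / (1 + k))"
  have r2: "R\<^sup>2 - r\<^sup>2 = R\<^sup>2 / (1 + k)"
    using k R by (simp add: r_def divide_simps)
  have r: "r \<ge> 0" "r < R"
  proof -
    show "r \<ge> 0" using k R by (simp add: r_def divide_simps)
    have "R\<^sup>2 / (1 + k) > 0" using k R by simp
    then have "r\<^sup>2 < R\<^sup>2" using r2 by linarith
    then show "r < R" using R by (simp add: power2_less_imp_less)
  qed
  define \<Phi> where "\<Phi> = (\<lambda>s. c * R\<^sup>2 / (R\<^sup>2 - s)\<^sup>2)"
  define W where "W = (\<lambda>y. \<Phi> ((norm (y - a))\<^sup>2))"
  have pos: "R\<^sup>2 - (norm (y - a))\<^sup>2 > 0" if "y \<in> cball a r" for y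
  proof -
    have "norm (y - a) < R" using that r by (auto simp: dist_norm norm_minus_commute)
    then show ?thesis using R by (simp add: power_strict_mono)
  qed
  have Wnn: "W y \<ge> 0" for y using c by (simp add: W_def \<Phi>_def)
  have Wa: "W a = U / 2" using R c ua R2 by (simp add: W_def \<Phi>_def power2_eq_square U_def)
  have Wr: "W y \<ge> M" if "norm (y - a) = r" for y
  proof -
    have "W y = c * R\<^sup>2 / (R\<^sup>2 / (1 + k))\<^sup>2" by (simp add: W_def \<Phi>_def that r2)
    also have "\<dots> = c * (1 + k)\<^sup>2 / R\<^sup>2" using R k by (simp add: field_simps power2_eq_square)
    also have "\<dots> \<ge> c * k / R\<^sup>2"
    proof -
      have "k \<le> (1 + k)\<^sup>2" using k by (simp add: power2_sum)
      then show ?thesis using c by (intro divide_right_mono mult_left_mono) auto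
    qed
    also have "c * k / R\<^sup>2 = M" using c R by (simp add: k_def)
    finally show ?thesis .
  qed
  \<comment> \<open>This is exp (w + f - W), continued by 0 to the vortices. It is continuous on the
    closed disc and exceeds 1 at \<open>a\<close>, so its maximum lies off the vortices and, by the
    choice of \<open>r\<close>, inside the disc.\<close>
  define G where "G = (\<lambda>y. exp_vf m z n w y * exp (- W y))"
  have "continuous_on (cball a r) W"
    unfolding W_def \<Phi>_def using pos by (intro continuous_intros) force
  then have "continuous_on (cball a r) G"
    unfolding G_def
    by (intro continuous_intros exp_vf_continuous n) (auto intro: continuous_on_subset[OF cw])
  then obtain x where x: "x \<in> cball a r" "\<And>y. y \<in> cball a r \<Longrightarrow> G y \<le> G x"
    using continuous_attains_sup[of "cball a r" G] r by (metis centre_in_cball compact_cball empty_iff)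
  have "G a > 1" using a ua Wa by (simp add: G_def exp_vf_def U_def exp_minus field_simps)
  then have Gx: "G x > 1" using x(2)[of a] r by simp
  then have xz: "x \<notin> z ` {1..m}" by (auto simp: G_def exp_vf_def)
  have G: "G y = exp (w y + f_bg m z n y - W y)" if "y \<notin> z ` {1..m}" for y
    using that by (simp add: G_def exp_vf_def exp_diff exp_minus field_simps)
  have ux: "w x + f_bg m z n x > W x" using Gx G[OF xz] by simp
  have "norm (x - a) \<noteq> r"
  proof
    assume "norm (x - a) = r"
    moreover have "w x \<le> M" using x(1) r by (intro M(1)) auto
    ultimately show False using Wr[of x] f_bg_nonpos[of m z n x] ux by simp
  qed
  then have xb: "x \<in> ball a r" using x(1) by (simp add: dist_norm norm_minus_commute)
  define s where "s = (norm (x - a))\<^sup>2"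
  have s: "s \<ge> 0" "R\<^sup>2 - s > 0" using pos[OF x(1)] by (auto simp: s_def)
  have "\<forall>\<^sub>F t in nhds s. (\<Phi> has_real_derivative 2 * c * R\<^sup>2 / (R\<^sup>2 - t) ^ 3) (at t)"
    using eventually_nhds_in_open[of "{..<R\<^sup>2}" s] s
  proof (auto elim!: eventually_mono)
    fix t assume "t < R\<^sup>2"
    then show "(\<Phi> has_real_derivative 2 * c * R\<^sup>2 / (R\<^sup>2 - t) ^ 3) (at t)"
      unfolding \<Phi>_def by (auto intro!: derivative_eq_intros simp: divide_simps) algebra
  qed
  moreover have "((\<lambda>t. 2 * c * R\<^sup>2 / (R\<^sup>2 - t) ^ 3) has_real_derivative
      6 * c * R\<^sup>2 / (R\<^sup>2 - s) ^ 4) (at s)"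
    using s by (auto intro!: derivative_eq_intros simp: divide_simps)
  ultimately have lapW: "has_laplacian_at W x (2 * real DIM(plane) * (2 * c * R\<^sup>2 / (R\<^sup>2 - s) ^ 3)
      + 4 * s * (6 * c * R\<^sup>2 / (R\<^sup>2 - s) ^ 4))"
    unfolding W_def s_def by (rule has_laplacian_at_radial)
  have "\<forall>\<^sub>F y in nhds x. y \<in> ball a r" using xb by (intro eventually_nhds_in_open) auto
  then have "\<forall>\<^sub>F y in nhds x. y \<notin> z ` {1..m} \<longrightarrow>
      w y + f_bg m z n y - W y \<le> w x + f_bg m z n x - W x"
  proof eventually_elim
    case (elim y)
    then show ?case using x(2)[of y] G[OF xz] G[of y] by auto
  qed
  from laplacian_at_max[OF w xz lapW this]
  have "2 * q\<^sup>2 * (exp_vf m z n w x - 1) \<le> 8 * c * R\<^sup>2 / (R\<^sup>2 - s) ^ 3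
      + 24 * c * R\<^sup>2 * s / (R\<^sup>2 - s) ^ 4" by (simp add: pde mult_ac)
  also have "\<dots> = c * R\<^sup>2 / (R\<^sup>2 - s) ^ 4 * (8 * (R\<^sup>2 - s) + 24 * s)"
    using s by (simp add: divide_simps) algebra
  also have "\<dots> \<le> c * R\<^sup>2 / (R\<^sup>2 - s) ^ 4 * (32 * R\<^sup>2)"
    using s c by (intro mult_left_mono) auto
  also have "\<dots> = q\<^sup>2 * (W x)\<^sup>2"
    using s q by (simp add: W_def \<Phi>_def s_def[symmetric] c_def divide_simps)
  also have "\<dots> \<le> q\<^sup>2 * (w x + f_bg m z n x)\<^sup>2"
    using ux Wnn[of x] by (intro mult_left_mono power_mono) auto
  finally have upper: "2 * (exp_vf m z n w x - 1) \<le> (w x + f_bg m z n x)\<^sup>2"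
    using q by (simp add: mult.assoc mult.left_commute[of 2])
  \<comment> \<open>With u = w + f at the maximum, the barrier gives 2 (e^u - 1) \<le> u^2, while
    e^u \<ge> 1 + u + u^2/2 for u \<ge> 0. Together they force u \<le> 0, against u > W \<ge>
    0.\<close>
  have lower: "1 + (w x + f_bg m z n x) + (w x + f_bg m z n x)\<^sup>2 / 2 \<le> exp_vf m z n w x"
    using exp_lower_Taylor_quadratic[of "w x + f_bg m z n x"] ux Wnn[of x] xz
    by (simp add: exp_vf_def)
  have "u \<le> 0" if "2 * (E - 1) \<le> s" "1 + u + s / 2 \<le> E" for u s E :: real
    using that by simp
  from this[OF upper lower] show False using ux Wnn[of x] by linarith
qed

section \<open>Sign and size bounds for a single topological solution\<close>

context
  fixes m :: nat and z :: "nat \<Rightarrow> plane" and n :: "nat \<Rightarrow> nat" and \<kappa> q :: real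
    and v A :: "plane \<Rightarrow> real"
  assumes n: "\<forall>j\<in>{1..m}. n j > 0" and \<kappa>: "\<kappa> > 0" and q: "q > 0"
    and sol: "topological_solution m z n \<kappa> q v A"
begin

lemma C_2_v: "C_k 2 v" and C_2_A: "C_k 2 A"
  using sol by (auto simp: topological_solution_def smooth_def)

lemma laplacian_v:
  "laplacian v x = 2 * q\<^sup>2 * (exp_vf m z n v x - 1) - 2 * q * \<kappa> * A x + g_bg m z n x"
  using sol by (simp add: topological_solution_def)

lemma laplacian_A:
  "laplacian A x = \<kappa> * q * (1 - exp_vf m z n v x) + (\<kappa>\<^sup>2 + 2 * q\<^sup>2 * exp_vf m z n v x) * A x"
  using sol by (simp add: topological_solution_def)

text \<open>At a maximum of \<phi> above 1, the Laplacian of v + f is 2 q^2 (\<phi> - 1) - 2 q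
  \<kappa> A, which is positive there.\<close>

lemma exp_le_1_if_A_nonpos:
  assumes "\<And>x. A x \<le> 0"
  shows "exp_vf m z n v y \<le> 1"
proof (rule ccontr)
  assume "\<not> exp_vf m z n v y \<le> 1"
  then have "exp_vf m z n v y > 1" by simp
  moreover have "(exp_vf m z n v \<longlongrightarrow> 1) at_infinity"
    using sol by (intro exp_vf_tendsto n) (simp add: topological_solution_def)
  moreover have "continuous_on UNIV (exp_vf m z n v)"
    by (intro exp_vf_continuous n C_2_continuous(1) C_2_v)
  ultimately obtain x where x: "\<And>y. exp_vf m z n v y \<le> exp_vf m z n v x" "exp_vf m z n v x > 1"
    using attains_max_above_limit[of "exp_vf m z n v" 1 y] by blast
  then have xz: "x \<notin> z ` {1..m}" by (auto simp: exp_vf_def)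
  have "v y + f_bg m z n y \<le> v x + f_bg m z n x" if "y \<notin> z ` {1..m}" for y
    using x(1)[of y] xz that by (simp add: exp_vf_def)
  then have "laplacian v x - g_bg m z n x \<le> 0"
    by (intro laplacian_at_max[OF C_2_v xz has_laplacian_at_const[of 0]]) simp
  moreover have "q * \<kappa> * A x \<le> 0" using assms[of x] \<kappa> q by (simp add: mult_nonneg_nonpos)
  moreover have "q\<^sup>2 * (exp_vf m z n v x - 1) > 0" using x(2) q by simp
  ultimately show False by (simp add: laplacian_v mult.assoc)
qed

text \<open>Since \<open>A\<close> tends to 0 at infinity, a positive value would force an attained
  positive maximum. The next two lemmas verify the hypothesis under different admissibility
  conditions.\<close>

lemma A_nonpos_if_laplacian_pos:
  assumes "\<And>x. A x > 0 \<Longrightarrow> laplacian A x > 0"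
  shows "A y \<le> 0"
proof (rule ccontr)
  assume "\<not> A y \<le> 0"
  then obtain x where x: "\<And>y. A y \<le> A x" "A x > 0"
    using attains_max_above_limit[of A 0 y] sol C_2_continuous(1)[OF C_2_A]
    by (metis topological_solution_def linorder_not_le)
  have "laplacian A x \<le> 0"
    using C_2_has_laplacian_at[OF C_2_A] by (rule has_laplacian_at_local_max) (simp add: x(1))
  with assms[OF x(2)] show False by simp
qed

lemma A_nonpos_if_exp_le_1:
  assumes "\<And>x. exp_vf m z n v x \<le> 1"
  shows "A y \<le> 0"
proof (rule A_nonpos_if_laplacian_pos)
  fix x assume "A x > 0"
  moreover have "\<kappa>\<^sup>2 + 2 * q\<^sup>2 * exp_vf m z n v x > 0"
    using \<kappa> by (intro add_pos_nonneg) (auto simp: exp_vf_nonneg)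
  ultimately show "laplacian A x > 0"
    unfolding laplacian_A using \<kappa> q assms[of x] by (intro add_nonneg_pos) auto
qed

lemma A_nonpos_if_A_ge:
  assumes "\<And>x. \<kappa> * A x \<ge> q * (exp_vf m z n v x - 1)"
  shows "A y \<le> 0"
proof (rule A_nonpos_if_laplacian_pos)
  fix x assume A: "A x > 0"
  have eq: "laplacian A x = \<kappa> * (\<kappa> * A x - q * (exp_vf m z n v x - 1)) + 2 * q\<^sup>2 * exp_vf m z n v x * A x"
    by (simp add: laplacian_A power2_eq_square algebra_simps)
  show "laplacian A x > 0"
  \<comment> \<open>At a vortex the term with \<open>exp_vf\<close> vanishes, and strict positivity
    comes from \<kappa> A + q instead.\<close>
  proof (cases "exp_vf m z n v x = 0")
    case True
    then show ?thesis unfolding eq using A \<kappa> q by (simp add: add_pos_pos)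
  next
    case False
    then have "exp_vf m z n v x > 0" using exp_vf_nonneg[of m z n v x] by simp
    then show ?thesis unfolding eq using A \<kappa> q assms[of x] by (intro add_nonneg_pos) auto
  qed
qed

text \<open>At a minimum of \<open>A\<close> below -q/\<kappa>, the Laplacian is \<kappa> (q +
  \<kappa> A) - \<kappa> q \<phi> + 2 q^2 \<phi> A, whose first term is negative and whose others
  are nonpositive. The bound excludes vortices in \<open>A_ge\<close> and later bounds |A| by
  q/\<kappa>.\<close>

lemma A_ge_minus:
  assumes "\<And>x. A x \<le> 0"
  shows "\<kappa> * A y \<ge> - q"
proof (rule ccontr)
  assume "\<not> \<kappa> * A y \<ge> - q"
  then have y: "- \<kappa> * A y > q" by simp
  have "((\<lambda>x. - \<kappa> * A x) \<longlongrightarrow> - \<kappa> * 0) at_infinity"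
    using sol by (intro tendsto_intros) (simp add: topological_solution_def)
  moreover have "continuous_on UNIV (\<lambda>x. - \<kappa> * A x)"
    using C_2_continuous(1)[OF C_2_A] by (intro continuous_intros)
  moreover have "- \<kappa> * A y > - \<kappa> * 0" using y q by simp
  ultimately obtain x where x: "\<And>y. - \<kappa> * A y \<le> - \<kappa> * A x"
    using attains_max_above_limit[of "\<lambda>x. - \<kappa> * A x" "- \<kappa> * 0" y] by blast
  have "- \<kappa> * laplacian A x \<le> 0"
    using has_laplacian_at_cmult[OF C_2_has_laplacian_at[OF C_2_A]]
    by (rule has_laplacian_at_local_max) (use x in simp)
  then have "laplacian A x \<ge> 0" using \<kappa> by (simp add: zero_le_mult_iff)
  moreover have "laplacian A x = \<kappa> * (q + \<kappa> * A x) + (- (\<kappa> * q * exp_vf m z n v x)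
      + 2 * q\<^sup>2 * (exp_vf m z n v x * A x))"
    by (simp add: laplacian_A power2_eq_square algebra_simps)
  moreover have "q + \<kappa> * A x < 0" using y x[of y] by linarith
  then have "\<kappa> * (q + \<kappa> * A x) < 0" by (rule mult_pos_neg[OF \<kappa>])
  moreover have "\<kappa> * q * exp_vf m z n v x \<ge> 0" using \<kappa> q by (simp add: exp_vf_nonneg)
  moreover have "q\<^sup>2 * (exp_vf m z n v x * A x) \<le> 0"
    using assms[of x] by (intro mult_nonneg_nonpos) (auto simp: exp_vf_nonneg mult_nonneg_nonpos)
  ultimately show False by linarith
qed

text \<open>With F = q \<phi> - \<kappa> A one has H = q - F, so F must not exceed q. At a maximum
  with F > q the Laplacian of F is at least (2 q^2 \<phi> + \<kappa>^2) (F - q) - 2 \<kappa> q^2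
  \<phi> A, which is positive because A \<le> 0.\<close>

lemma A_ge:
  assumes "\<And>x. A x \<le> 0"
  shows "\<kappa> * A y \<ge> q * (exp_vf m z n v y - 1)"
proof (rule ccontr)
  define F where "F = (\<lambda>x. q * exp_vf m z n v x - \<kappa> * A x)"
  assume "\<not> \<kappa> * A y \<ge> q * (exp_vf m z n v y - 1)"
  then have "F y > q" by (simp add: F_def algebra_simps)
  moreover have "(F \<longlongrightarrow> q * 1 - \<kappa> * 0) at_infinity"
    unfolding F_def using sol
    by (intro tendsto_intros exp_vf_tendsto n) (simp_all add: topological_solution_def)
  moreover have "continuous_on UNIV F"
    unfolding F_def using C_2_continuous(1)[OF C_2_A] C_2_continuous(1)[OF C_2_v]
    by (intro continuous_intros exp_vf_continuous n)
  ultimately obtain x where x: "\<And>y. F y \<le> F x" "F x > q"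
    using attains_max_above_limit[of F q y] by auto
  \<comment> \<open>At a vortex \<phi> = 0, so F = -\<kappa> A \<le> q by
    \<open>A_ge_minus\<close>.\<close>
  have xz: "x \<notin> z ` {1..m}"
    using x(2) A_ge_minus[OF assms, of x] by (auto simp: F_def exp_vf_def)
  obtain K where K: "has_laplacian_at (\<lambda>y. exp (v y + f_bg m z n y)) x K"
    "exp (v x + f_bg m z n x) * (laplacian v x + - g_bg m z n x) \<le> K"
    by (rule has_laplacian_at_exp[OF has_laplacian_at_add[OF
        C_2_has_laplacian_at[OF C_2_v] f_bg_has_laplacian_at[OF xz]]])
  have "has_laplacian_at (\<lambda>y. q * exp (v y + f_bg m z n y) - \<kappa> * A y) x (q * K - \<kappa> * laplacian A x)"
    by (intro has_laplacian_at_diff has_laplacian_at_cmult K C_2_has_laplacian_at C_2_A)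
  moreover have "\<forall>\<^sub>F y in nhds x. q * exp (v y + f_bg m z n y) - \<kappa> * A y
      \<le> q * exp (v x + f_bg m z n x) - \<kappa> * A x"
    using eventually_not_vortex[OF xz]
  proof eventually_elim
    case (elim y)
    then show ?case using x(1)[of y] xz by (simp add: F_def exp_vf_def)
  qed
  ultimately have "q * K - \<kappa> * laplacian A x \<le> 0"
    by (rule has_laplacian_at_local_max)
  moreover define \<phi> where "\<phi> = exp_vf m z n v x"
  \<comment> \<open>The equation for \<open>v\<close> reads \<Delta>(v + f) = 2 q (F - q) off the
    vortices.\<close>
  have "\<phi> * (2 * q * (F x - q)) \<le> K"
    using K(2) xz by (simp add: \<phi>_def exp_vf_def F_def laplacian_v power2_eq_square algebra_simps)
  then have "q * (\<phi> * (2 * q * (F x - q))) \<le> q * K" using q by (intro mult_left_mono) auto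
  moreover have "\<kappa> * laplacian A x = - (\<kappa>\<^sup>2 * (F x - q)) + 2 * \<kappa> * (q\<^sup>2 * (\<phi> * A x))"
    by (simp add: laplacian_A F_def \<phi>_def power2_eq_square algebra_simps)
  moreover have "\<kappa> * (q\<^sup>2 * (\<phi> * A x)) \<le> 0"
    using assms[of x] \<kappa> exp_vf_nonneg[of m z n v x]
    by (intro mult_nonneg_nonpos) (auto simp: \<phi>_def)
  moreover have "\<kappa>\<^sup>2 * (F x - q) > 0" using \<kappa> x(2) by simp
  moreover have "q * (\<phi> * (2 * q * (F x - q))) \<ge> 0"
    using q x(2) exp_vf_nonneg[of m z n v x] by (simp add: \<phi>_def)
  ultimately show False by linarith
qed

text \<open>Each admissibility condition yields A \<le> 0 or \<phi> \<le> 1 everywhere; the latter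
  implies the former, and A \<le> 0 gives all three bounds. In the fourth case \<phi> is compared
  with its Abelian Higgs counterpart, which is at most 1.\<close>

lemma admissible_bounds:
  assumes "admissible m z n \<kappa> q v A"
  shows "exp_vf m z n v x \<le> 1" "A x \<le> 0" "\<kappa> * A x \<ge> q * (exp_vf m z n v x - 1)"
proof -
  have "(\<forall>x. A x \<le> 0) \<or> (\<forall>x. exp_vf m z n v x \<le> 1)"
    using assms unfolding admissible_def
  proof (elim disjE exE conjE)
    assume "\<forall>x. x \<notin> z ` {1..m} \<longrightarrow> v x \<le> - f_bg m z n x"
    then have "\<forall>x. exp_vf m z n v x \<le> 1" by (force simp: exp_vf_def)
    then show ?thesis ..
  next
    assume "\<forall>x. A x \<ge> q / \<kappa> * (exp_vf m z n v x - 1)"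
    then have "\<kappa> * A x \<ge> q * (exp_vf m z n v x - 1)" for x
      using \<kappa> by (simp add: divide_simps mult.commute)
    then show ?thesis using A_nonpos_if_A_ge by blast
  next
    fix w assume w: "abelian_higgs_solution m z n q w" and vw: "\<forall>x. v x \<le> w x"
    have "exp_vf m z n v x \<le> exp_vf m z n w x" for x using vw by (simp add: exp_vf_def)
    moreover have "exp_vf m z n w x \<le> 1" for x
      using w by (intro abelian_higgs_exp_le_1[OF n _ q])
        (auto simp: abelian_higgs_solution_def smooth_def)
    ultimately have "\<forall>x. exp_vf m z n v x \<le> 1" by (meson order_trans)
    then show ?thesis ..
  qed simp
  then have A: "A x \<le> 0" for x using A_nonpos_if_exp_le_1 by blast
  show "exp_vf m z n v x \<le> 1" "A x \<le> 0" "\<kappa> * A x \<ge> q * (exp_vf m z n v x - 1)"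
    using exp_le_1_if_A_nonpos A_ge A by blast+
qed

end

section \<open>The limit\<close>

lemma test_function_bounded:
  assumes "test_function \<psi>"
  obtains R M :: real where "R \<ge> 0" "M \<ge> 0" "\<And>x. norm x > R \<Longrightarrow> \<psi> x = 0" "\<And>x. \<bar>\<psi> x\<bar> \<le> M"
proof -
  have K: "compact (closure {x. \<psi> x \<noteq> 0})" and c: "continuous_on UNIV \<psi>"
    using assms C_2_continuous(1) by (auto simp: test_function_def smooth_def)
  then have "bounded (closure {x. \<psi> x \<noteq> 0})" "bounded (\<psi> ` closure {x. \<psi> x \<noteq> 0})"
    by (auto intro!: compact_imp_bounded compact_continuous_image intro: continuous_on_subset)
  then obtain R M where R: "\<forall>x\<in>closure {x. \<psi> x \<noteq> 0}. norm x \<le> R"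
    and M: "\<forall>x\<in>closure {x. \<psi> x \<noteq> 0}. \<bar>\<psi> x\<bar> \<le> M"
    by (auto simp: bounded_iff)
  have cl: "\<psi> x \<noteq> 0 \<Longrightarrow> x \<in> closure {x. \<psi> x \<noteq> 0}" for x
    using closure_subset by force
  show ?thesis
  proof (rule that[of "max R 0" "max M 0"])
    show "\<psi> x = 0" if "norm x > max R 0" for x
      using R cl[of x] that by force
    show "\<bar>\<psi> x\<bar> \<le> max M 0" for x
      using M cl[of x] by (cases "\<psi> x = 0") (auto simp: le_max_iff_disj)
  qed simp_all
qed

lemma abs_integral_mult_le:
  fixes u w :: "'a::euclidean_space \<Rightarrow> real"
  assumes "continuous_on UNIV u" "continuous_on UNIV w" "\<And>x. norm x > R \<Longrightarrow> w x = 0"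
    and "\<And>x. \<bar>u x\<bar> \<le> c"
  shows "\<bar>LINT x|lborel. u x * w x\<bar> \<le> c * (LINT x|lborel. \<bar>w x\<bar>)"
proof -
  have i: "integrable lborel (\<lambda>x. \<bar>w x\<bar>)"
    using assms by (intro continuous_compact_support_integrable[where R=R] continuous_intros) auto
  have "\<bar>LINT x|lborel. u x * w x\<bar> \<le> (LINT x|lborel. \<bar>u x * w x\<bar>)"
    using integral_norm_bound[of lborel "\<lambda>x. u x * w x"] by simp
  also have "\<dots> \<le> (LINT x|lborel. c * \<bar>w x\<bar>)"
    using assms i
    by (intro integral_mono continuous_compact_support_integrable[where R=R] continuous_intros)
      (auto simp: abs_mult intro!: mult_right_mono)
  finally show ?thesis by simp
qed

text \<open>The bound is a constant depending only on \<open>l\<close>, \<psi> and \<open>w\<close>,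
  divided by \<kappa>. The majorant \<open>w\<close> enters because H \<ge> 0 controls integrals of
  H against nonnegative functions, while \<psi> may change sign.\<close>

lemma limit_equation_defect_bound:
  fixes \<psi> w :: "plane \<Rightarrow> real"
  assumes n: "\<forall>j\<in>{1..m}. n j > 0" and \<kappa>: "\<kappa> \<ge> 1" and q: "q > 0" and l: "q\<^sup>2 / \<kappa> = l"
    and sol: "topological_solution m z n \<kappa> q v A" and adm: "admissible m z n \<kappa> q v A"
    and \<psi>: "C_k 2 \<psi>" "\<And>x. norm x > R \<Longrightarrow> \<psi> x = 0"
    and w: "C_k 2 w" "\<And>x. norm x > R \<Longrightarrow> w x = 0" "\<And>x. \<bar>\<psi> x\<bar> \<le> w x"
  shows "\<bar>LINT x|lborel. (laplacian v x - 4 * l\<^sup>2 * exp_vf m z n v x * (exp_vf m z n v x - 1)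
      - g_bg m z n x) * \<psi> x\<bar>
    \<le> (4 * l\<^sup>2 * ((LINT x|lborel. \<bar>laplacian w x\<bar>) + 2 * l * (LINT x|lborel. \<bar>w x\<bar>))
        + 2 * l * (LINT x|lborel. \<bar>laplacian \<psi> x\<bar>)) / \<kappa>"
proof -
  have \<kappa>0: "\<kappa> > 0" using \<kappa> by simp
  have q2: "q\<^sup>2 = l * \<kappa>" using l \<kappa>0 by auto
  have l0: "l > 0" using l \<kappa>0 q by auto
  define \<phi> where "\<phi> = exp_vf m z n v"
  define H where "H = (\<lambda>x. \<kappa> * A x - q * (\<phi> x - 1))"
  note bounds = admissible_bounds[OF n \<kappa>0 q sol adm]
  have \<phi>: "0 \<le> \<phi> x" "\<phi> x \<le> 1" for x using bounds by (simp_all add: \<phi>_def exp_vf_nonneg)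
  have H: "H x \<ge> 0" for x using bounds by (simp add: H_def \<phi>_def)
  have A: "\<bar>A x\<bar> \<le> q / \<kappa>" for x
    using A_ge_minus[OF n \<kappa>0 q sol bounds(2), of x] bounds(2)[of x] \<kappa>0
    by (simp add: abs_of_nonpos field_simps)
  have C2: "C_k 2 v" "C_k 2 A" using sol by (auto simp: topological_solution_def smooth_def)
  have cont: "continuous_on UNIV A" "continuous_on UNIV (laplacian A)" "continuous_on UNIV \<phi>"
    "continuous_on UNIV \<psi>" "continuous_on UNIV (laplacian \<psi>)"
    "continuous_on UNIV w" "continuous_on UNIV (laplacian w)"
    unfolding \<phi>_def using C_2_continuous C2 \<psi>(1) w(1) by (auto intro!: exp_vf_continuous n)
  then have cH: "continuous_on UNIV H" unfolding H_def by (intro continuous_intros)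
  note int = continuous_compact_support_integrable[where R=R]
  have lapA: "laplacian A x = \<kappa> * H x + 2 * q\<^sup>2 * \<phi> x * A x" for x
    using sol by (simp add: topological_solution_def H_def \<phi>_def power2_eq_square algebra_simps)

  \<comment> \<open>Testing the equation for \<open>A\<close> against \<open>w\<close> isolates
    \<kappa> times the integral of H w; the other terms involve only \<open>A\<close>, which is at
    most q/\<kappa> in absolute value.\<close>
  have "(LINT x|lborel. laplacian A x * w x)
      = (LINT x|lborel. \<kappa> * (H x * w x) + 2 * q\<^sup>2 * (\<phi> x * A x * w x))"
    by (simp add: lapA algebra_simps)
  also have "\<dots> = \<kappa> * (LINT x|lborel. H x * w x) + 2 * q\<^sup>2 * (LINT x|lborel. \<phi> x * A x * w x)"
    using cont cH w(2) by (subst Bochner_Integration.integral_add)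
      (auto intro!: integrable_mult_right int continuous_intros)
  finally have "\<kappa> * (LINT x|lborel. H x * w x)
      = (LINT x|lborel. A x * laplacian w x) - 2 * q\<^sup>2 * (LINT x|lborel. \<phi> x * A x * w x)"
    using green_identity[OF C2(2) w(1,2)] by simp
  also have "\<dots> \<le> q / \<kappa> * (LINT x|lborel. \<bar>laplacian w x\<bar>) + 2 * q\<^sup>2 * (q / \<kappa> * (LINT x|lborel. \<bar>w x\<bar>))"
  proof -
    have "\<bar>LINT x|lborel. A x * laplacian w x\<bar> \<le> q / \<kappa> * (LINT x|lborel. \<bar>laplacian w x\<bar>)"
      using cont A laplacian_eq_0[of R w, OF w(2)] by (intro abs_integral_mult_le[where R=R]) auto
    moreover have "\<bar>LINT x|lborel. \<phi> x * A x * w x\<bar> \<le> q / \<kappa> * (LINT x|lborel. \<bar>w x\<bar>)"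
    proof (rule abs_integral_mult_le[where R=R])
      show "\<bar>\<phi> x * A x\<bar> \<le> q / \<kappa>" for x
        using mult_mono[OF \<phi>(2)[of x] A[of x]] \<phi>(1)[of x] by (simp add: abs_mult)
    qed (use cont w(2) in \<open>auto intro!: continuous_intros\<close>)
    then have "2 * q\<^sup>2 * \<bar>LINT x|lborel. \<phi> x * A x * w x\<bar> \<le> 2 * q\<^sup>2 * (q / \<kappa> * (LINT x|lborel. \<bar>w x\<bar>))"
      by (intro mult_left_mono) auto
    moreover have "- (2 * q\<^sup>2 * (LINT x|lborel. \<phi> x * A x * w x))
        \<le> 2 * q\<^sup>2 * \<bar>LINT x|lborel. \<phi> x * A x * w x\<bar>"
      unfolding minus_mult_right by (intro mult_left_mono) auto
    ultimately show ?thesis by linarith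
  qed
  \<comment> \<open>The first term uses 1/\<kappa> \<le> 1; in the second, q^2 = l \<kappa> cancels
    the 1/\<kappa>.\<close>
  also have "\<dots> \<le> q * ((LINT x|lborel. \<bar>laplacian w x\<bar>) + 2 * l * (LINT x|lborel. \<bar>w x\<bar>))"
  proof -
    have "q / \<kappa> * (LINT x|lborel. \<bar>laplacian w x\<bar>) \<le> q * (LINT x|lborel. \<bar>laplacian w x\<bar>)"
      using \<kappa> q by (intro mult_right_mono) (auto simp: field_simps)
    moreover have "2 * q\<^sup>2 * (q / \<kappa> * (LINT x|lborel. \<bar>w x\<bar>)) = q * (2 * l * (LINT x|lborel. \<bar>w x\<bar>))"
      using \<kappa>0 by (simp add: q2)
    ultimately show ?thesis by (simp add: distrib_left)
  qed
  finally have Hw: "(LINT x|lborel. H x * w x)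
      \<le> q / \<kappa> * ((LINT x|lborel. \<bar>laplacian w x\<bar>) + 2 * l * (LINT x|lborel. \<bar>w x\<bar>))"
    using \<kappa>0 by (simp add: field_simps)

  have "\<bar>LINT x|lborel. \<phi> x * H x * \<psi> x\<bar> \<le> (LINT x|lborel. \<bar>\<phi> x * H x * \<psi> x\<bar>)"
    using integral_norm_bound[of lborel "\<lambda>x. \<phi> x * H x * \<psi> x"] by simp
  also have "\<dots> \<le> (LINT x|lborel. H x * w x)"
  proof (rule integral_mono)
    show "\<bar>\<phi> x * H x * \<psi> x\<bar> \<le> H x * w x" for x
    proof -
      have "\<phi> x * H x \<le> H x" using mult_right_mono[OF \<phi>(2) H] by simp
      then have "\<phi> x * H x * \<bar>\<psi> x\<bar> \<le> H x * w x"
        by (intro mult_mono w(3) H) auto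
      then show ?thesis using \<phi>(1) H by (simp add: abs_mult)
    qed
  qed (use cont cH \<psi>(2) w(2) in \<open>auto intro!: int continuous_intros\<close>)
  also note Hw
  finally have first: "\<bar>LINT x|lborel. \<phi> x * H x * \<psi> x\<bar>
      \<le> q / \<kappa> * ((LINT x|lborel. \<bar>laplacian w x\<bar>) + 2 * l * (LINT x|lborel. \<bar>w x\<bar>))" .

  have second: "\<bar>LINT x|lborel. A x * laplacian \<psi> x\<bar> \<le> q / \<kappa> * (LINT x|lborel. \<bar>laplacian \<psi> x\<bar>)"
    using cont A laplacian_eq_0[of R \<psi>, OF \<psi>(2)] by (intro abs_integral_mult_le[where R=R]) auto

  \<comment> \<open>Directly, \<Delta>v - g = -2 q H, but H is only O(q/\<kappa>) in local L^1, so
    this is merely O(l). Trading it for \<Delta>A, whose derivatives move onto \<psi>, leaves H with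
    the small factor 4 l^2 / q; here l \<kappa> / q = q matches the terms \<phi> A.\<close>
  have pointwise: "laplacian v x - 4 * l\<^sup>2 * \<phi> x * (\<phi> x - 1) - g_bg m z n x
      = 4 * l\<^sup>2 / q * (\<phi> x * H x) - 2 * q / \<kappa> * laplacian A x" for x
  proof -
    have "laplacian v x - g_bg m z n x = - (2 * q * H x)"
      using sol by (simp add: topological_solution_def H_def \<phi>_def power2_eq_square algebra_simps)
    moreover have "2 * q / \<kappa> * laplacian A x = 2 * q * H x + 4 * l * q * (\<phi> x * A x)"
      using \<kappa>0 by (simp add: lapA q2 field_simps)
    moreover have "4 * l\<^sup>2 / q * (\<phi> x * H x) = 4 * l * q * (\<phi> x * A x) - 4 * l\<^sup>2 * \<phi> x * (\<phi> x - 1)"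
    proof -
      have "l * \<kappa> / q = q" using q by (simp add: q2[symmetric] power2_eq_square)
      then have "4 * l * (l * \<kappa> / q) * (\<phi> x * A x) = 4 * l * q * (\<phi> x * A x)" by simp
      then show ?thesis using q by (simp add: H_def field_simps power2_eq_square)
    qed
    ultimately show ?thesis by linarith
  qed
  have "(LINT x|lborel. (laplacian v x - 4 * l\<^sup>2 * \<phi> x * (\<phi> x - 1) - g_bg m z n x) * \<psi> x)
      = (LINT x|lborel. 4 * l\<^sup>2 / q * (\<phi> x * H x * \<psi> x) - 2 * q / \<kappa> * (laplacian A x * \<psi> x))"
    unfolding pointwise by (simp add: left_diff_distrib mult.assoc)
  also have "\<dots> = 4 * l\<^sup>2 / q * (LINT x|lborel. \<phi> x * H x * \<psi> x)
      - 2 * q / \<kappa> * (LINT x|lborel. A x * laplacian \<psi> x)"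
    using cont cH \<psi>(2) green_identity[OF C2(2) \<psi>] q \<kappa>0
    by (subst Bochner_Integration.integral_diff) (auto intro!: integrable_mult_right int continuous_intros)
  also have "\<bar>\<dots>\<bar> \<le> 4 * l\<^sup>2 / q * \<bar>LINT x|lborel. \<phi> x * H x * \<psi> x\<bar>
      + 2 * q / \<kappa> * \<bar>LINT x|lborel. A x * laplacian \<psi> x\<bar>"
    by (rule order_trans[OF abs_triangle_ineq4]) (use q \<kappa>0 in \<open>simp add: abs_mult\<close>)
  also have "\<dots> \<le> 4 * l\<^sup>2 / q * (q / \<kappa> * ((LINT x|lborel. \<bar>laplacian w x\<bar>) + 2 * l * (LINT x|lborel. \<bar>w x\<bar>)))
      + 2 * q / \<kappa> * (q / \<kappa> * (LINT x|lborel. \<bar>laplacian \<psi> x\<bar>))"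
    using q \<kappa>0 by (intro add_mono mult_left_mono first second) auto
  \<comment> \<open>In the first term q cancels; in the second q^2 / \<kappa> = l. Both keep one
    factor 1/\<kappa>.\<close>
  also have "4 * l\<^sup>2 / q * (q / \<kappa> * a) = 4 * l\<^sup>2 * a / \<kappa>" for a using q by simp
  also have "2 * q / \<kappa> * (q / \<kappa> * a) = 2 * l * a / \<kappa>" for a
  proof -
    have "2 * q / \<kappa> * (q / \<kappa> * a) = 2 * (q\<^sup>2 / \<kappa>) * a / \<kappa>" by (simp add: power2_eq_square)
    then show ?thesis using l by simp
  qed
  finally show ?thesis by (simp add: \<phi>_def add_divide_distrib)
qed

theorem theorem5:
  fixes m :: nat and z :: "nat \<Rightarrow> plane" and n :: "nat \<Rightarrow> nat" and l :: real
    and v A\<^sub>0 :: "real \<Rightarrow> real \<Rightarrow> plane \<Rightarrow> real" and \<psi> :: "plane \<Rightarrow> real"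
  assumes "m \<ge> 1"
    and "\<And>j. j \<in> {1..m} \<Longrightarrow> n j > 0"
    and "l > 0"
    and "\<And>\<kappa> q. \<kappa> > 0 \<Longrightarrow> q > 0 \<Longrightarrow> q\<^sup>2 / \<kappa> = l \<Longrightarrow>
           topological_solution m z n \<kappa> q (v \<kappa> q) (A\<^sub>0 \<kappa> q) \<and>
           admissible m z n \<kappa> q (v \<kappa> q) (A\<^sub>0 \<kappa> q)"
    and "test_function \<psi>"
  shows "((\<lambda>(\<kappa>, q). LINT x|lborel.
             (laplacian (v \<kappa> q) x
              - 4 * l\<^sup>2 * exp_vf m z n (v \<kappa> q) x * (exp_vf m z n (v \<kappa> q) x - 1)
              - g_bg m z n x) * \<psi> x)
           \<longlongrightarrow> 0)
         (inf (at_top \<times>\<^sub>F at_top) (principal {(\<kappa>, q). q\<^sup>2 / \<kappa> = l}))"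
proof -
  obtain R M where RM: "R \<ge> 0" "M \<ge> 0" "\<And>x. norm x > R \<Longrightarrow> \<psi> x = 0" "\<And>x. \<bar>\<psi> x\<bar> \<le> M"
    using test_function_bounded[OF assms(5)] by blast
  obtain w :: "plane \<Rightarrow> real" and S where w: "C_k 2 w" "\<And>x. w x \<ge> 0"
    "\<And>x. norm x > S \<Longrightarrow> w x = 0" "\<And>x. norm x \<le> R \<Longrightarrow> M \<le> w x"
    using cutoff_exists[OF RM(1,2)] by blast
  have \<psi>w: "\<bar>\<psi> x\<bar> \<le> w x" for x
    using RM(3)[of x] RM(4)[of x] w(2)[of x] w(4)[of x] by (cases "norm x \<le> R") auto
  have \<psi>: "C_k 2 \<psi>" using assms(5) by (simp add: test_function_def smooth_def)
  have supp: "norm x > max R S \<Longrightarrow> \<psi> x = 0" "norm x > max R S \<Longrightarrow> w x = 0" for x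
    using RM(3) w(3) by auto
  \<comment> \<open>\<open>C\<close> does not depend on \<kappa> or q, since \<open>w\<close> was
    chosen from \<psi> alone.\<close>
  define C where "C = 4 * l\<^sup>2 * ((LINT x|lborel. \<bar>laplacian w x\<bar>) + 2 * l * (LINT x|lborel. \<bar>w x\<bar>))
    + 2 * l * (LINT x|lborel. \<bar>laplacian \<psi> x\<bar>)"
  define I where "I = (\<lambda>(\<kappa>, q). LINT x|lborel.
             (laplacian (v \<kappa> q) x
              - 4 * l\<^sup>2 * exp_vf m z n (v \<kappa> q) x * (exp_vf m z n (v \<kappa> q) x - 1)
              - g_bg m z n x) * \<psi> x)"
  let ?F = "at_top \<times>\<^sub>F at_top :: (real \<times> real) filter"
  let ?G = "inf ?F (principal {(\<kappa>, q). q\<^sup>2 / \<kappa> = l})"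
  have "\<forall>\<^sub>F p in ?F. fst p \<ge> 1 \<and> snd p \<ge> 1"
    by (intro eventually_conj eventually_compose_filterlim[OF eventually_ge_at_top filterlim_fst]
        eventually_compose_filterlim[OF eventually_ge_at_top filterlim_snd])
  then have "\<forall>\<^sub>F p in ?G. norm (I p) \<le> C / fst p"
    unfolding eventually_inf_principal
  proof (rule eventually_mono, intro impI)
    fix p :: "real \<times> real"
    assume elim: "fst p \<ge> 1 \<and> snd p \<ge> 1" "p \<in> {(\<kappa>, q). q\<^sup>2 / \<kappa> = l}"
    obtain \<kappa> q where p: "p = (\<kappa>, q)" by (cases p)
    have "\<kappa> \<ge> 1" "q > 0" "q\<^sup>2 / \<kappa> = l" using elim p by auto
    moreover from this have "topological_solution m z n \<kappa> q (v \<kappa> q) (A\<^sub>0 \<kappa> q)"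
      "admissible m z n \<kappa> q (v \<kappa> q) (A\<^sub>0 \<kappa> q)" using assms(4)[of \<kappa> q] by auto
    ultimately show "norm (I p) \<le> C / fst p"
      using limit_equation_defect_bound[of m n \<kappa> q l z "v \<kappa> q" "A\<^sub>0 \<kappa> q" \<psi> "max R S" w]
        assms(2) \<psi> supp w(1) \<psi>w
      by (simp add: p I_def C_def)
  qed
  \<comment> \<open>The bound already tends to 0 without the constraint q^2 / \<kappa> = l, hence
    also along the smaller filter.\<close>
  moreover have "((\<lambda>p. C / fst p) \<longlongrightarrow> 0) ?G"
  proof (rule tendsto_mono[OF inf_le1])
    show "((\<lambda>p. C / fst p) \<longlongrightarrow> 0) ?F"
      by (intro tendsto_divide_0[OF tendsto_const] filterlim_at_top_imp_at_infinity filterlim_fst)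
  qed
  ultimately have "(I \<longlongrightarrow> 0) ?G" by (rule Lim_null_comparison)
  then show ?thesis unfolding I_def .
qed

end
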